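(* For every integer $r>2$, the mixed graph $H_r$ (defined in the context) is an $(r,1,2)$-mixed radial Moore graph, and its status vector is $$\mathbf{s}(H_r):\ (2r^2+3r+3)^{2},\ (2r^2+3r+4)^{r-1},\ (2r^2+4r+2)^{2},\ (3r^2+5)^{r^2-2r-1},\ (3r^2+6)^{5},\ (3r^2+7)^{2r-3},\ (3r^2+r+5)^{r-3},\ (3r^2+r+6)^{2},$$ where $a^{m}$ means that the value $a$ is listed $m$ times (i.e. the multiset of the statuses of all vertices of $H_r$ is the multiset union of these entries).
   Context: A mixed graph $G=(V,E,A)$ has a finite vertex set $V$, a set $E$ of undirected edges and a set $A$ of directed edges (arcs). The undirected degree of a vertex is the number of edges incident to it; its out-degree (in-degree) is the number of arcs leaving (entering) it. $G$ is totally $(r,z)$-regular if every vertex has undirected degree $r$, in-degree $z$ and out-degree $z$. A walk of length $\ell$ from $u$ to $v$ is a sequence $u=u_0,u_1,\dots,u_\ell=v$ such that for each $i$ the pair $u_{i-1}u_i$ is an edge, or an arc from $u_{i-1}$ to $u_i$. The distance $d(u,v)$ is the length of a shortest path from $u$ to $v$. The out-eccentricity of $u$ is the maximum distance from $u$ to any vertex; the radius is the minimum and the diameter the maximum of the out-eccentricities. The status of $v$ is $s(v)=\sum_{u\in V}d(v,u)$, and the status vector $\mathbf{s}(G)$ is the vector of the statuses of all vertices. An $(r,z,k)$-mixed radial Moore graph is a totally $(r,z)$-regular mixed graph of radius $k$, diameter $k+1$ and order $M(r,z,k)$, the mixed Moore bound; for $k=2$ one has $M(r,z,2)=(r+z)^2+z+1$,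 so $M(r,1,2)=r^2+2r+3$. Definition of $H_r$ ($r>2$). The vertices are the integers $0,1,\dots,r+1$, the pairs $(i,j)$ with $1\le i\le r+1$, $1\le j\le r$, and the pair $(r+1,r+1)$. Edges are denoted $x\sim y$ and arcs $x\to y$. The edges and arcs are the following. (0) (Moore tree rooted at $0$) Edges $0\sim i$ for $1\le i\le r$; the arc $0\to r+1$; edges $i\sim(i,j)$ for $1\le i\le r$, $1\le j\le r-1$; arcs $i\to(i,r)$ for $1\le i\le r$; edges $r+1\sim(r+1,j)$ for $1\le j\le r$; the arc $r+1\to(r+1,r+1)$. (1) Edges $(i,j)\sim(u,v)$ for all distinct pairs $(i,j)\ne(u,v)$ with $j-i\equiv v-u\pmod{r+1}$, where $i,u\in\{1,\dots,r+1\}$ and $j,v\in\{1,\dots,r\}$ (the vertex $(r+1,r+1)$ is not included here). (2) Edges $(i,r)\sim(r+1,r+1)$ for $i=1,\dots,r$. (3) The arc $(r+1,r+1)\to 0$. (4) Arcs $(r+1,i)\to r+1-i$ for $i=1,\dots,r$. (5) Arcs $(i,r)\to(r+1,r+1-i)$ for $i=1,\dots,r$. (6) Arcs $(i,j)\to(r+i-j,\,r-j)$ for $i=1,\dots,r$ and $j=1,\dots,r-1$ with $j-i\not\equiv r\pmod{r+1}$, where the indices of the last vertex are taken modulo $r+1$ (with representatives in $\{1,\dots,r+1\}$). (7) Arcs $(i,j)\to(i-1,j)$ for $i=1,\dots,r$ and $j=1,\dots,r-1$ with $j-i\equiv r\pmod{r+1}$. *)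

theory Defs
  imports "HOL-Library.Multiset" "HOL-Library.Extended_Nat" "HOL-Number_Theory.Cong"
begin

record 'a mixed_graph =
  verts :: "'a set"
  edges :: "'a set set"
  arcs :: "('a \<times> 'a) set"

text \<open>Edges are two-element sets and arcs are ordered pairs of distinct vertices (no loops).\<close>

definition is_mixed_graph :: "'a mixed_graph \<Rightarrow> bool" where
  "is_mixed_graph G \<longleftrightarrow>
     finite (verts G) \<and> verts G \<noteq> {} \<and>
     (\<forall>e \<in> edges G. e \<subseteq> verts G \<and> card e = 2) \<and>
     (\<forall>(u, v) \<in> arcs G. u \<in> verts G \<and> v \<in> verts G \<and> u \<noteq> v)"

definition undirected_degree :: "'a mixed_graph \<Rightarrow> 'a \<Rightarrow> nat" where
  "undirected_degree G v = card {e \<in> edges G. v \<in> e}"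

definition out_degree :: "'a mixed_graph \<Rightarrow> 'a \<Rightarrow> nat" where
  "out_degree G v = card {a \<in> arcs G. fst a = v}"

definition in_degree :: "'a mixed_graph \<Rightarrow> 'a \<Rightarrow> nat" where
  "in_degree G v = card {a \<in> arcs G. snd a = v}"

definition totally_regular :: "'a mixed_graph \<Rightarrow> nat \<Rightarrow> nat \<Rightarrow> bool" where
  "totally_regular G r z \<longleftrightarrow>
     (\<forall>v \<in> verts G. undirected_degree G v = r \<and> in_degree G v = z \<and> out_degree G v = z)"

definition mixed_adj :: "'a mixed_graph \<Rightarrow> 'a \<Rightarrow> 'a \<Rightarrow> bool" where
  "mixed_adj G u v \<longleftrightarrow> {u, v} \<in> edges G \<or> (u, v) \<in> arcs G"

text \<open>A walk is given by its list of vertices, so its length is one less than that of the list.\<close>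

definition is_walk :: "'a mixed_graph \<Rightarrow> 'a \<Rightarrow> 'a list \<Rightarrow> 'a \<Rightarrow> bool" where
  "is_walk G u p v \<longleftrightarrow>
     p \<noteq> [] \<and> hd p = u \<and> last p = v \<and> set p \<subseteq> verts G \<and> successively (mixed_adj G) p"

definition is_path :: "'a mixed_graph \<Rightarrow> 'a \<Rightarrow> 'a list \<Rightarrow> 'a \<Rightarrow> bool" where
  "is_path G u p v \<longleftrightarrow> is_walk G u p v \<and> distinct p"

text \<open>The distance is \<open>\<infinity>\<close> if there is no path.\<close>

definition mixed_dist :: "'a mixed_graph \<Rightarrow> 'a \<Rightarrow> 'a \<Rightarrow> enat" where
  "mixed_dist G u v = (INF p \<in> {p. is_path G u p v}. enat (length p - 1))"

definition out_eccentricity :: "'a mixed_graph \<Rightarrow> 'a \<Rightarrow> enat" where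
  "out_eccentricity G u = Max (mixed_dist G u ` verts G)"

definition mixed_radius :: "'a mixed_graph \<Rightarrow> enat" where
  "mixed_radius G = Min (out_eccentricity G ` verts G)"

definition mixed_diameter :: "'a mixed_graph \<Rightarrow> enat" where
  "mixed_diameter G = Max (out_eccentricity G ` verts G)"

definition status :: "'a mixed_graph \<Rightarrow> 'a \<Rightarrow> enat" where
  "status G v = (\<Sum>u \<in> verts G. mixed_dist G v u)"

text \<open>The status vector, up to the order of its entries.\<close>

definition status_vector :: "'a mixed_graph \<Rightarrow> enat multiset" where
  "status_vector G = image_mset (status G) (mset_set (verts G))"

text \<open>
  The mixed Moore bound is the number of vertices of the mixed Moore tree of depth \<open>k\<close>.
  At level \<open>t\<close> of that tree the two components count the vertices reached from their parent
  by an edge and by an arc.  The former have \<open>r - 1\<close> further edges, the latter have \<open>r\<close>, and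
  both have \<open>z\<close> outgoing arcs; the root has as many children as a vertex reached by an arc.
\<close>

primrec moore_level :: "nat \<Rightarrow> nat \<Rightarrow> nat \<Rightarrow> nat \<times> nat" where
  "moore_level r z 0 = (0, 1)"
| "moore_level r z (Suc t) =
     (case moore_level r z t of (e, a) \<Rightarrow> ((r - 1) * e + r * a, z * (e + a)))"

definition mixed_moore_bound :: "nat \<Rightarrow> nat \<Rightarrow> nat \<Rightarrow> nat" where
  "mixed_moore_bound r z k = (\<Sum>t\<le>k. case moore_level r z t of (e, a) \<Rightarrow> e + a)"

lemma mixed_moore_bound_2: "mixed_moore_bound r z 2 = (r + z)\<^sup>2 + z + 1"
  by (cases r) (auto simp: mixed_moore_bound_def numeral_2_eq_2 algebra_simps)

definition mixed_radial_moore_graph :: "nat \<Rightarrow> nat \<Rightarrow> nat \<Rightarrow> 'a mixed_graph \<Rightarrow> bool" where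
  "mixed_radial_moore_graph r z k G \<longleftrightarrow>
     is_mixed_graph G \<and> totally_regular G r z \<and>
     mixed_radius G = enat k \<and> mixed_diameter G = enat (k + 1) \<and>
     card (verts G) = mixed_moore_bound r z k"

text \<open>\<open>Sg i\<close> is the vertex \<open>i\<close> and \<open>Pr i j\<close> is the vertex \<open>(i, j)\<close> of \<open>H\<^sub>r\<close>.\<close>

datatype H_vertex = Sg nat | Pr nat nat

text \<open>The representative of \<open>x\<close> modulo \<open>r + 1\<close> in \<open>{1..r + 1}\<close>.\<close>

definition idx :: "nat \<Rightarrow> int \<Rightarrow> nat" where
  "idx r x = nat ((x - 1) mod int (r + 1) + 1)"

definition H_verts :: "nat \<Rightarrow> H_vertex set" where
  "H_verts r =
     {Sg i |i. i \<le> r + 1} \<union>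
     {Pr i j |i j. i \<in> {1..r + 1} \<and> j \<in> {1..r}} \<union>
     {Pr (r + 1) (r + 1)}"

definition H_edges :: "nat \<Rightarrow> H_vertex set set" where
  "H_edges r =
     {{Sg 0, Sg i} |i. i \<in> {1..r}} \<union>
     {{Sg i, Pr i j} |i j. i \<in> {1..r} \<and> j \<in> {1..r - 1}} \<union>
     {{Sg (r + 1), Pr (r + 1) j} |j. j \<in> {1..r}} \<union>
     {{Pr i j, Pr u v} |i j u v.
        i \<in> {1..r + 1} \<and> u \<in> {1..r + 1} \<and> j \<in> {1..r} \<and> v \<in> {1..r} \<and> (i, j) \<noteq> (u, v) \<and>
        [int j - int i = int v - int u] (mod int (r + 1))} \<union>
     {{Pr i r, Pr (r + 1) (r + 1)} |i. i \<in> {1..r}}"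

definition H_arcs :: "nat \<Rightarrow> (H_vertex \<times> H_vertex) set" where
  "H_arcs r =
     {(Sg 0, Sg (r + 1))} \<union>
     {(Sg i, Pr i r) |i. i \<in> {1..r}} \<union>
     {(Sg (r + 1), Pr (r + 1) (r + 1))} \<union>
     {(Pr (r + 1) (r + 1), Sg 0)} \<union>
     {(Pr (r + 1) i, Sg (r + 1 - i)) |i. i \<in> {1..r}} \<union>
     {(Pr i r, Pr (r + 1) (r + 1 - i)) |i. i \<in> {1..r}} \<union>
     {(Pr i j, Pr (idx r (int r + int i - int j)) (idx r (int r - int j))) |i j.
        i \<in> {1..r} \<and> j \<in> {1..r - 1} \<and> \<not> [int j - int i = int r] (mod int (r + 1))} \<union>
     {(Pr i j, Pr (i - 1) j) |i j.
        i \<in> {1..r} \<and> j \<in> {1..r - 1} \<and> [int j - int i = int r] (mod int (r + 1))}"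

definition H_graph :: "nat \<Rightarrow> H_vertex mixed_graph" where
  "H_graph r = \<lparr>verts = H_verts r, edges = H_edges r, arcs = H_arcs r\<rparr>"

end

theory Submission
  imports Defs
begin

text \<open>
  Write \<open>B\<^sub>k(v)\<close> for the set of vertices at distance at most \<open>k\<close> from \<open>v\<close>.  A vertex at distance
  \<open>d\<close> from \<open>v\<close> lies outside exactly \<open>d\<close> of the balls \<open>B\<^sub>0(v), B\<^sub>1(v), \<dots>\<close>, so the status of \<open>v\<close> is the sum
  over \<open>k\<close> of the number of vertices outside \<open>B\<^sub>k(v)\<close> (\<open>status_eq_sum_card\<close>).  In \<open>H\<^sub>r\<close> we have
  \<open>|B\<^sub>0(v)| = 1\<close>, by regularity \<open>|B\<^sub>1(v)| = r + 2\<close>, and \<open>B\<^sub>3(v)\<close> is the whole graph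
  (\<open>ball_3_H\<close>).  Hence the status equals \<open>3r\<^sup>2 + 5r + 6 - |B\<^sub>2(v)|\<close> (\<open>status_H\<close>), and everything comes
  down to the sizes of the balls of radius two.

  The vertices \<open>(i, j)\<close> with \<open>j \<le> r\<close> form \<open>r + 1\<close> disjoint cliques: clique \<open>c\<close>, with
  \<open>0 \<le> c \<le> r\<close>, consists of those with \<open>j - i \<equiv> c\<close> modulo \<open>r + 1\<close> and has one member in each column
  \<open>j\<close>.  Besides its clique, such a vertex has only one further neighbour (its tree neighbour)
  and the head of its one arc.  So its ball of radius two is made up of its clique, the tree neighbours and
  the arc heads of that clique, and the closed neighbourhoods of its own tree neighbour and arc head.
  The point of rule (6) is that the arcs leaving clique \<open>c < r\<close> from columns other than
  \<open>c\<close> and \<open>r\<close> end in the single row \<open>r - c\<close>.  The ball is thus a union of at most two cliques, parts of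
  rows, of the main diagonal or of the last column, almost all vertices \<open>k\<close> and a few single vertices,
  and its size is about \<open>5r\<close> (about \<open>4r\<close> in most of clique \<open>r\<close>).
  Which of these pieces happen to meet decides between the values in the status vector.

  A vertex \<open>i\<close> with \<open>1 \<le> i \<le> r\<close> has an edge or arc to one member of each clique except clique
  \<open>r + 1 - i\<close>, and the arcs that rules (5) and (6) give from row \<open>i\<close> all run into just that clique
  and reach every member but \<open>(i - 1, r)\<close>.
  So its ball of radius two is everything but at most one vertex (\<open>ball_2_Sg\<close>).  The vertices \<open>r + 1\<close>
  and \<open>(r + 1, r + 1)\<close> also see one member of each clique except one, of which they reach a single vertex
  in two steps (\<open>ball_2_Sg_last\<close>, \<open>ball_2_last\<close>).  As every vertex of a clique has an edge or arc to a
  vertex of one of these kinds, the ball of radius three around it is complete up to a few vertices, and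
  these are easily reached as well.
\<close>

section \<open>Distances, eccentricities and statuses from balls\<close>

primrec ball :: "'a mixed_graph \<Rightarrow> nat \<Rightarrow> 'a \<Rightarrow> 'a set" where
  "ball G 0 u = {u}"
| "ball G (Suc k) u = ball G k u \<union> {w. \<exists>v \<in> ball G k u. mixed_adj G v w}"

lemma mixed_adj_verts:
  assumes "is_mixed_graph G" "mixed_adj G u v"
  shows "u \<in> verts G" "v \<in> verts G"
  using assms unfolding is_mixed_graph_def mixed_adj_def by auto

lemma ball_subset_verts:
  assumes "is_mixed_graph G" "u \<in> verts G"
  shows "ball G k u \<subseteq> verts G"
  using assms(2) by (induction k) (auto dest: mixed_adj_verts[OF assms(1)])

lemma walk_in_ball:
  assumes "is_walk G u p v"
  shows "v \<in> ball G (length p - 1) u"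
  using assms
proof (induction p arbitrary: v rule: rev_induct)
  case Nil
  then show ?case by (simp add: is_walk_def)
next
  case (snoc w p)
  show ?case
  proof (cases "p = []")
    case True
    then show ?thesis using snoc.prems by (auto simp: is_walk_def)
  next
    case False
    then have "is_walk G u p (last p)" and adj: "mixed_adj G (last p) v"
      using snoc.prems by (auto simp: is_walk_def successively_append_iff)
    then have "last p \<in> ball G (length p - 1) u" using snoc.IH by blast
    then have "v \<in> ball G (Suc (length p - 1)) u" using adj by auto
    then show ?thesis using False by simp
  qed
qed

lemma ball_imp_walk:
  assumes "is_mixed_graph G" "u \<in> verts G" "v \<in> ball G k u"
  shows "\<exists>p. is_walk G u p v \<and> length p \<le> Suc k"
  using assms(3)
proof (induction k arbitrary: v)
  case 0
  then show ?case using assms(2) by (intro exI[of _ "[u]"]) (simp add: is_walk_def)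
next
  case (Suc k)
  show ?case
  proof (cases "v \<in> ball G k u")
    case True
    then show ?thesis using Suc.IH le_SucI by blast
  next
    case False
    then obtain w where w: "w \<in> ball G k u" "mixed_adj G w v" using Suc.prems by auto
    then obtain p where p: "is_walk G u p w" "length p \<le> Suc k" using Suc.IH by blast
    then have "is_walk G u (p @ [v]) v"
      using w(2) mixed_adj_verts(2)[OF assms(1) w(2)]
      by (auto simp: is_walk_def successively_append_iff)
    then show ?thesis using p(2) by (intro exI[of _ "p @ [v]"]) simp
  qed
qed

text \<open>
  A shortest walk repeats no vertex: a repetition encloses a closed section that can be cut out.
\<close>

lemma walk_imp_path:
  assumes "is_walk G u p v"
  shows "\<exists>q. is_path G u q v \<and> length q \<le> length p"
  using assms
proof (induction p rule: length_induct)
  case (1 p)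
  show ?case
  proof (cases "distinct p")
    case True
    then show ?thesis using "1.prems" by (auto simp: is_path_def)
  next
    case False
    then obtain as x bs cs where p: "p = as @ [x] @ bs @ [x] @ cs"
      using not_distinct_decomp by blast
    have "is_walk G u (as @ [x] @ cs) v"
      using "1.prems" unfolding p is_walk_def
      by (cases as; cases cs)
        (auto simp: successively_append_iff successively_Cons hd_append split: if_splits)
    moreover have "length (as @ [x] @ cs) < length p" using p by simp
    ultimately obtain q where "is_path G u q v" "length q \<le> length (as @ [x] @ cs)"
      using "1.IH" by blast
    then show ?thesis using p by (intro exI[of _ q]) auto
  qed
qed

lemma ball_mono: "k \<le> l \<Longrightarrow> ball G k u \<subseteq> ball G l u"
  by (rule lift_Suc_mono_le[of "\<lambda>k. ball G k u"]) auto

text \<open>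
  Distances are infima over paths, balls describe walks; the two agree because walks contain paths.
\<close>

lemma mixed_dist_le_iff:
  assumes "is_mixed_graph G" "u \<in> verts G"
  shows "mixed_dist G u v \<le> enat k \<longleftrightarrow> v \<in> ball G k u"
proof
  assume "v \<in> ball G k u"
  then obtain p where "is_path G u p v" "length p \<le> Suc k"
    using ball_imp_walk[OF assms] walk_imp_path le_trans by metis
  then have "mixed_dist G u v \<le> enat (length p - 1)" "length p - 1 \<le> k"
    unfolding mixed_dist_def by (auto intro: INF_lower)
  then show "mixed_dist G u v \<le> enat k" using order_trans enat_ord_simps(1) by metis
next
  assume le: "mixed_dist G u v \<le> enat k"
  let ?D = "(\<lambda>p. enat (length p - 1)) ` {p. is_path G u p v}"
  have "?D \<noteq> {}"
  proof
    assume "?D = {}"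
    then have "mixed_dist G u v = \<infinity>" unfolding mixed_dist_def by (simp only: Inf_enat_def) simp
    then show False using le by simp
  qed
  then have "mixed_dist G u v \<in> ?D"
    unfolding mixed_dist_def Inf_enat_def by (metis (no_types, lifting) LeastI ex_in_conv)
  then obtain p where p: "is_path G u p v" "mixed_dist G u v = enat (length p - 1)" by auto
  then have "v \<in> ball G (length p - 1) u" by (auto simp: is_path_def dest: walk_in_ball)
  then show "v \<in> ball G k u" using p(2) le ball_mono[of "length p - 1" k G u] by auto
qed

lemma out_eccentricity_le_iff:
  assumes "is_mixed_graph G" "u \<in> verts G"
  shows "out_eccentricity G u \<le> enat k \<longleftrightarrow> ball G k u = verts G"
proof -
  have "finite (verts G)" "verts G \<noteq> {}" using assms(1) by (auto simp: is_mixed_graph_def)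
  then have "out_eccentricity G u \<le> enat k \<longleftrightarrow> (\<forall>v \<in> verts G. v \<in> ball G k u)"
    unfolding out_eccentricity_def by (simp add: mixed_dist_le_iff[OF assms])
  then show ?thesis using ball_subset_verts[OF assms, of k] by blast
qed

text \<open>
  The distance from \<open>u\<close> to \<open>v\<close> counts the radii \<open>k\<close> for which \<open>v\<close> is outside the ball around \<open>u\<close>.  Exchanging the
  two summations turns the sum of distances into a sum of numbers of missing vertices.
\<close>

lemma status_eq_sum_card:
  assumes "is_mixed_graph G" "u \<in> verts G" "ball G K u = verts G"
  shows "status G u = enat (\<Sum>k<K. card (verts G - ball G k u))"
proof -
  have fin: "finite (verts G)" using assms(1) by (simp add: is_mixed_graph_def)
  have d: "mixed_dist G u v = enat (\<Sum>k<K. if v \<in> ball G k u then 0 else 1)"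
    if v: "v \<in> verts G" for v
  proof -
    have "mixed_dist G u v \<le> enat K" using mixed_dist_le_iff[OF assms(1,2)] v assms(3) by simp
    then obtain d where d: "mixed_dist G u v = enat d" "d \<le> K"
      by (cases "mixed_dist G u v") auto
    have "v \<in> ball G k u \<longleftrightarrow> d \<le> k" for k
      using mixed_dist_le_iff[OF assms(1,2), of v k] d by simp
    then have "(\<Sum>k<K. if v \<in> ball G k u then 0 else 1) = (\<Sum>k<K. if k < d then 1 else (0::nat))"
      by (intro sum.cong) auto
    also have "\<dots> = card {k \<in> {..<K}. k < d}"
      by (simp only: sum.inter_filter[symmetric] finite_lessThan sum_constant) simp
    also have "{k \<in> {..<K}. k < d} = {..<d}" using d(2) by auto
    finally show ?thesis using d(1) by simp
  qed
  have "status G u = (\<Sum>v\<in>verts G. enat (\<Sum>k<K. if v \<in> ball G k u then 0 else 1))"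
    unfolding status_def by (intro sum.cong refl d)
  also have "\<dots> = enat (\<Sum>v\<in>verts G. \<Sum>k<K. if v \<in> ball G k u then 0 else 1)"
    by (simp only: of_nat_eq_enat[symmetric] of_nat_sum)
  also have "(\<Sum>v\<in>verts G. \<Sum>k<K. if v \<in> ball G k u then 0 else (1::nat))
      = (\<Sum>k<K. \<Sum>v\<in>verts G. if v \<in> ball G k u then 0 else 1)"
    by (rule sum.swap)
  also have "\<dots> = (\<Sum>k<K. card (verts G - ball G k u))"
    by (intro sum.cong refl) (simp add: sum.If_cases fin Diff_eq)
  finally show ?thesis .
qed

section \<open>Degrees in mixed graphs\<close>

lemma undirected_degree_eq_card:
  assumes "is_mixed_graph G"
  shows "undirected_degree G v = card {w. {v, w} \<in> edges G}"
proof -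
  have "\<exists>w. e = {v, w}" if "e \<in> edges G" "v \<in> e" for e
  proof -
    have "card e = 2" using assms that(1) by (auto simp: is_mixed_graph_def)
    then obtain x y where "e = {x, y}" by (auto simp: card_2_iff)
    then show ?thesis using that(2) by auto
  qed
  then have "{e \<in> edges G. v \<in> e} = (\<lambda>w. {v, w}) ` {w. {v, w} \<in> edges G}" by auto
  moreover have "inj_on (\<lambda>w. {v, w}) X" for X by (auto simp: inj_on_def doubleton_eq_iff)
  ultimately show ?thesis by (simp add: undirected_degree_def card_image)
qed

text \<open>
  A vertex \<open>v\<close> has one outgoing arc because \<open>f\<close> is a function, and one incoming arc because \<open>f\<close> is
  injective and surjective.
\<close>

lemma degrees_permutation_arcs:
  assumes "arcs G = (\<lambda>v. (v, f v)) ` verts G" "bij_betw f (verts G) (verts G)" "v \<in> verts G"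
  shows "out_degree G v = 1" "in_degree G v = 1"
proof -
  have "{a \<in> arcs G. fst a = v} = {(v, f v)}" using assms(1,3) by auto
  then show "out_degree G v = 1" by (simp add: out_degree_def)
  obtain u where u: "u \<in> verts G" "f u = v"
    using assms(2,3) by (metis bij_betw_imp_surj_on imageE)
  then have "{a \<in> arcs G. snd a = v} = {(u, v)}"
    using assms(1,2) by (auto simp: bij_betw_def inj_on_def)
  then show "in_degree G v = 1" by (simp add: in_degree_def)
qed

section \<open>Neighbourhoods without congruences\<close>

text \<open>
  In the index range of \<open>H\<^sub>r\<close> both differences lie strictly between \<open>-(r + 1)\<close> and \<open>r\<close>, so the
  only multiples of the modulus by which they can differ are \<open>0\<close> and \<open>\<plusminus>(r + 1)\<close>.  This and the
  next lemmas replace all congruences by linear conditions, which arithmetic can decide.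
\<close>

lemma cong_diff_iff:
  assumes "i \<in> {1..r + 1}" "u \<in> {1..r + 1}" "j \<in> {1..r}" "v \<in> {1..r}"
  shows "[int j - int i = int v - int u] (mod int (r + 1)) \<longleftrightarrow>
    j + u = v + i \<or> j + u + (r + 1) = v + i \<or> j + u = v + i + (r + 1)"
proof
  assume "[int j - int i = int v - int u] (mod int (r + 1))"
  then obtain k where k: "int j - int i - (int v - int u) = int (r + 1) * k"
    by (auto simp: cong_iff_dvd_diff dvd_def)
  have "\<not> k \<ge> 2"
  proof
    assume "k \<ge> 2"
    then have "int (r + 1) * 2 \<le> int (r + 1) * k" by (intro mult_left_mono) auto
    then show False using k assms by auto
  qed
  moreover have "\<not> k \<le> -2"
  proof
    assume "k \<le> -2"
    then have "int (r + 1) * k \<le> int (r + 1) * (-2)" by (intro mult_left_mono) auto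
    then show False using k assms by auto
  qed
  ultimately have "k = -1 \<or> k = 0 \<or> k = 1" by linarith
  then show "j + u = v + i \<or> j + u + (r + 1) = v + i \<or> j + u = v + i + (r + 1)"
    using k by (elim disjE) auto
next
  have "int j - int i - (int v - int u) = int (j + u) - int (v + i)" by simp
  moreover assume "j + u = v + i \<or> j + u + (r + 1) = v + i \<or> j + u = v + i + (r + 1)"
  ultimately have "int j - int i - (int v - int u) \<in> {0, int (r + 1), - int (r + 1)}" by auto
  then show "[int j - int i = int v - int u] (mod int (r + 1))"
    unfolding cong_iff_dvd_diff using dvd_minus_iff[of "int (r + 1)" "int (r + 1)"] by force
qed

text \<open>
  Every vertex is the tail of exactly one arc.  The last two lines are rule (6) with the
  reduction modulo \<open>r + 1\<close> carried out.
\<close>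

fun arc_head :: "nat \<Rightarrow> H_vertex \<Rightarrow> H_vertex" where
  "arc_head r (Sg i) =
     (if i = 0 then Sg (r + 1) else if i \<le> r then Pr i r else Pr (r + 1) (r + 1))"
| "arc_head r (Pr i j) =
     (if j = r + 1 then Sg 0
      else if i = r + 1 then Sg (r + 1 - j)
      else if j = r then Pr (r + 1) (r + 1 - i)
      else if i = j + 1 then Pr j j
      else if i \<le> j then Pr (r + i - j) (r - j)
      else Pr (i - (j + 1)) (r - j))"

definition clique_of :: "nat \<Rightarrow> nat \<Rightarrow> nat \<Rightarrow> H_vertex set" where
  "clique_of r i j = {Pr u v |u v. u \<in> {1..r + 1} \<and> v \<in> {1..r} \<and>
     (j + u = v + i \<or> j + u + (r + 1) = v + i \<or> j + u = v + i + (r + 1))}"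

fun edge_nbrs :: "nat \<Rightarrow> H_vertex \<Rightarrow> H_vertex set" where
  "edge_nbrs r (Sg i) =
     (if i = 0 then Sg ` {1..r}
      else if i \<le> r then insert (Sg 0) (Pr i ` {1..r - 1})
      else Pr (r + 1) ` {1..r})"
| "edge_nbrs r (Pr i j) =
     (if j = r + 1 then (\<lambda>i. Pr i r) ` {1..r}
      else insert (if i = r + 1 then Sg (r + 1) else if j = r then Pr (r + 1) (r + 1) else Sg i)
             (clique_of r i j - {Pr i j}))"

lemma H_edge_Sg_Sg:
  "{Sg i, Sg k} \<in> H_edges r \<longleftrightarrow> i = 0 \<and> k \<in> {1..r} \<or> k = 0 \<and> i \<in> {1..r}"
  by (auto simp: H_edges_def doubleton_eq_iff)

lemma H_edge_Sg_Pr: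
  "{Sg i, Pr u v} \<in> H_edges r \<longleftrightarrow>
    u = i \<and> (i \<in> {1..r} \<and> v \<in> {1..r - 1} \<or> i = r + 1 \<and> v \<in> {1..r})"
  by (auto simp: H_edges_def doubleton_eq_iff)

lemma H_edge_Pr_Pr:
  "{Pr i j, Pr u v} \<in> H_edges r \<longleftrightarrow>
    i \<in> {1..r + 1} \<and> j \<in> {1..r} \<and> Pr u v \<in> clique_of r i j - {Pr i j} \<or>
    i \<in> {1..r} \<and> j = r \<and> u = r + 1 \<and> v = r + 1 \<or>
    u \<in> {1..r} \<and> v = r \<and> i = r + 1 \<and> j = r + 1"
proof -
  let ?c = "\<lambda>i j u v. i \<in> {1..r + 1} \<and> u \<in> {1..r + 1} \<and> j \<in> {1..r} \<and> v \<in> {1..r} \<and>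
    (i, j) \<noteq> (u, v) \<and> [int j - int i = int v - int u] (mod int (r + 1))"
  have "{Pr i j, Pr u v} \<in> H_edges r \<longleftrightarrow> (?c i j u v \<or> ?c u v i j) \<or>
    i \<in> {1..r} \<and> j = r \<and> u = r + 1 \<and> v = r + 1 \<or>
    u \<in> {1..r} \<and> v = r \<and> i = r + 1 \<and> j = r + 1"
    unfolding H_edges_def by (simp only: Un_iff mem_Collect_eq doubleton_eq_iff H_vertex.simps) blast
  also have "?c i j u v \<or> ?c u v i j \<longleftrightarrow> ?c i j u v"
    using cong_sym by blast
  also have "\<dots> \<longleftrightarrow> i \<in> {1..r + 1} \<and> j \<in> {1..r} \<and> Pr u v \<in> clique_of r i j - {Pr i j}"
    using cong_diff_iff[of i r u j v] by (auto simp only: clique_of_def)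
  finally show ?thesis .
qed

lemma H_edge_iff:
  assumes "r > 2" "v \<in> H_verts r"
  shows "{v, w} \<in> H_edges r \<longleftrightarrow> w \<in> edge_nbrs r v"
proof (cases v)
  case (Sg i)
  then show ?thesis
    using assms by (cases w) (auto simp: H_edge_Sg_Sg H_edge_Sg_Pr H_verts_def)
next
  case (Pr i j)
  show ?thesis
  proof (cases w)
    case (Sg k)
    then show ?thesis
      using assms \<open>v = Pr i j\<close> H_edge_Sg_Pr[of k i j r]
      by (auto simp: insert_commute H_verts_def clique_of_def)
  next
    case w: (Pr k l)
    show ?thesis
      using assms unfolding Pr w H_edge_Pr_Pr
      by (auto simp: H_verts_def clique_of_def)
  qed
qed

text \<open>
  Modulo \<open>r + 1\<close> the residue \<open>r\<close> is \<open>-1\<close>, so rule (7) concerns the subdiagonal.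
\<close>

lemma cong_last_iff:
  assumes "i \<in> {1..r}" "j \<in> {1..r - 1}"
  shows "[int j - int i = int r] (mod int (r + 1)) \<longleftrightarrow> i = j + 1"
proof -
  have "[int j - int i = int r] (mod int (r + 1)) \<longleftrightarrow>
      [int j - int i = int r - int (r + 1)] (mod int (r + 1))"
  proof -
    have "int j - int i - (int r - int (r + 1)) = int j - int i - int r + int (r + 1)" by simp
    then show ?thesis unfolding cong_iff_dvd_diff by (simp only: dvd_add_triv_right_iff)
  qed
  also have "\<dots> \<longleftrightarrow> i = j + 1"
    using assms by (subst cong_diff_iff) auto
  finally show ?thesis .
qed

lemma idx_eq:
  "1 \<le> x \<Longrightarrow> x \<le> int (r + 1) \<Longrightarrow> idx r x = nat x"
  "int (r + 1) < x \<Longrightarrow> x \<le> 2 * int (r + 1) \<Longrightarrow> idx r x = nat x - (r + 1)"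
proof -
  assume "1 \<le> x" "x \<le> int (r + 1)"
  then show "idx r x = nat x" by (simp add: idx_def)
next
  assume x: "int (r + 1) < x" "x \<le> 2 * int (r + 1)"
  have "(x - 1) mod int (r + 1) = (x - 1 - int (r + 1)) mod int (r + 1)"
    by (simp only: minus_mod_self2)
  also have "\<dots> = x - 1 - int (r + 1)" using x by (intro mod_pos_pos_trivial) auto
  finally show "idx r x = nat x - (r + 1)" using x by (auto simp: idx_def)
qed

lemma idx_arc:
  assumes "i \<in> {1..r}" "j \<in> {1..r - 1}" "i \<noteq> j + 1"
  shows "Pr (idx r (int r + int i - int j)) (idx r (int r - int j)) =
    (if i \<le> j then Pr (r + i - j) (r - j) else Pr (i - (j + 1)) (r - j))"
proof (cases "i \<le> j")
  case True
  then have "idx r (int r + int i - int j) = nat (int r + int i - int j)"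
    "idx r (int r - int j) = nat (int r - int j)"
    using assms by (intro idx_eq; simp; linarith)+
  then show ?thesis using True by (simp add: nat_diff_distrib' nat_add_distrib)
next
  case False
  then have "idx r (int r + int i - int j) = nat (int r + int i - int j) - (r + 1)"
    "idx r (int r - int j) = nat (int r - int j)"
    using assms by (intro idx_eq; simp; linarith)+
  moreover have "nat (int r + int i - int j) - (r + 1) = i - (j + 1)" "nat (int r - int j) = r - j"
    using assms False by auto
  ultimately show ?thesis using False by simp
qed

text \<open>
  The classes (0) and (3) to (7) of arcs have disjoint sets of tails that cover all vertices.
\<close>

lemma H_arcs_eq:
  assumes "r > 2"
  shows "H_arcs r = (\<lambda>v. (v, arc_head r v)) ` H_verts r"
proof -
  have m: "{1..r - 1} = {1..<r}" using assms by auto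
  have a6: "{(Pr i j, Pr (idx r (int r + int i - int j)) (idx r (int r - int j))) |i j.
        i \<in> {1..r} \<and> j \<in> {1..r - 1} \<and> \<not> [int j - int i = int r] (mod int (r + 1))} =
      {(Pr i j, if i \<le> j then Pr (r + i - j) (r - j) else Pr (i - (j + 1)) (r - j)) |i j.
        i \<in> {1..r} \<and> j \<in> {1..r - 1} \<and> i \<noteq> j + 1}"
  proof ((rule Collect_cong, rule ex_cong1, rule ex_cong1), goal_cases)
    case (1 a i j)
    show ?case
    proof (cases "i \<in> {1..r} \<and> j \<in> {1..r - 1}")
      case True
      then have c: "[int j - int i = int r] (mod int (r + 1)) \<longleftrightarrow> i = j + 1"
        by (intro cong_last_iff) auto
      show ?thesis unfolding c
        using True idx_arc[of i r j] by (cases "i = j + 1") (blast, presburger)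
    next
      case False
      then show ?thesis by meson
    qed
  qed
  have a7: "{(Pr i j, Pr (i - 1) j) |i j.
        i \<in> {1..r} \<and> j \<in> {1..r - 1} \<and> [int j - int i = int r] (mod int (r + 1))} =
      {(Pr i j, Pr (i - 1) j) |i j. i \<in> {1..r} \<and> j \<in> {1..r - 1} \<and> i = j + 1}"
  proof ((rule Collect_cong, rule ex_cong1, rule ex_cong1), goal_cases)
    case (1 a i j)
    show ?case
    proof (cases "i \<in> {1..r} \<and> j \<in> {1..r - 1}")
      case True
      then have c: "[int j - int i = int r] (mod int (r + 1)) \<longleftrightarrow> i = j + 1"
        by (intro cong_last_iff) auto
      show ?thesis unfolding c
        using True idx_arc[of i r j] by (cases "i = j + 1") (blast, presburger)
    next
      case False
      then show ?thesis by meson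
    qed
  qed
  show ?thesis
  proof (intro equalityI subsetI)
    fix a assume "a \<in> H_arcs r"
    then show "a \<in> (\<lambda>v. (v, arc_head r v)) ` H_verts r"
      unfolding H_arcs_def a6 a7 unfolding m using assms by (auto simp: H_verts_def image_iff)
  next
    fix a assume "a \<in> (\<lambda>v. (v, arc_head r v)) ` H_verts r"
    then obtain v where a: "a = (v, arc_head r v)" and v: "v \<in> H_verts r" by auto
    show "a \<in> H_arcs r"
    proof (cases v)
      case (Sg i)
      then consider "i = 0" | "i \<in> {1..r}" | "i = r + 1" using v by (force simp: H_verts_def)
      then show ?thesis unfolding a Sg H_arcs_def by cases auto
    next
      case (Pr i j)
      then consider "i = r + 1" "j = r + 1" | "i = r + 1" "j \<in> {1..r}" | "i \<in> {1..r}" "j = r"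
        | "i \<in> {1..r}" "j \<in> {1..<r}" "i = j + 1" | "i \<in> {1..r}" "j \<in> {1..<r}" "i \<noteq> j + 1"
        using v by (force simp: H_verts_def)
      then show ?thesis
        unfolding a Pr H_arcs_def a6 a7 unfolding m using assms by cases auto
    qed
  qed
qed

section \<open>Clique coordinates\<close>

text \<open>
  The vertex \<open>(i, x)\<close> of clique \<open>c\<close> in column \<open>x\<close>: its row \<open>i\<close> is the representative of \<open>x - c\<close>.
  Clique and column determine the vertex, and the row is found without reduction modulo \<open>r + 1\<close>.
\<close>

definition diag :: "nat \<Rightarrow> nat \<Rightarrow> nat \<Rightarrow> H_vertex" where
  "diag r c x = Pr (if c < x then x - c else x + (r + 1) - c) x"

definition clique :: "nat \<Rightarrow> nat \<Rightarrow> H_vertex set" where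
  "clique r c = diag r c ` {1..r}"

text \<open>
  The one neighbour by an edge outside the clique.  The case \<open>x = c\<close> is row \<open>r + 1\<close>.
\<close>

definition tree_nbr :: "nat \<Rightarrow> nat \<Rightarrow> nat \<Rightarrow> H_vertex" where
  "tree_nbr r c x =
     (if x = c then Sg (r + 1) else if x = r then Pr (r + 1) (r + 1)
      else if c < x then Sg (x - c) else Sg (x + (r + 1) - c))"

text \<open>
  The arcs in clique coordinates.  The four cases are rules (4), (5), (7) and (6).  In the last case
  the row \<open>r - c\<close> of the head does not depend on the column \<open>x\<close>.
\<close>

definition diag_arc :: "nat \<Rightarrow> nat \<Rightarrow> nat \<Rightarrow> H_vertex" where
  "diag_arc r c x =
     (if x = c then Sg (r + 1 - c) else if x = r then Pr (r + 1) (c + 1)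
      else if c = r then Pr x x else Pr (r - c) (r - x))"

lemma Pr_in_clique_iff:
  assumes "c \<le> r"
  shows "Pr i j \<in> clique r c \<longleftrightarrow>
    i \<in> {1..r + 1} \<and> j \<in> {1..r} \<and> (j = i + c \<or> j + (r + 1) = i + c)"
  using assms by (auto simp: clique_def diag_def image_iff)

lemma Sg_notin_clique [simp]: "Sg i \<notin> clique r c"
  by (auto simp: clique_def diag_def)

lemma diag_inject:
  assumes "c \<le> r" "d \<le> r" "x \<in> {1..r}" "y \<in> {1..r}"
  shows "diag r c x = diag r d y \<longleftrightarrow> c = d \<and> x = y"
  using assms by (auto simp: diag_def split: if_splits)

lemma finite_clique [simp]: "finite (clique r c)"
  by (simp add: clique_def)

lemma card_clique: "card (clique r c) = r"
  unfolding clique_def by (subst card_image) (auto simp: inj_on_def diag_def)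

lemma Pr_eq_diag:
  assumes "i \<in> {1..r + 1}" "j \<in> {1..r}"
  shows "Pr i j = diag r (if i \<le> j then j - i else j + (r + 1) - i) j"
  using assms by (auto simp: diag_def)

lemma H_verts_cases:
  assumes "v \<in> H_verts r"
  obtains i where "v = Sg i" "i \<le> r + 1"
    | "v = Pr (r + 1) (r + 1)"
    | c x where "v = diag r c x" "c \<le> r" "x \<in> {1..r}"
proof -
  have "\<exists>c x. v = diag r c x \<and> c \<le> r \<and> x \<in> {1..r}"
    if "v = Pr i j" "i \<in> {1..r + 1}" "j \<in> {1..r}" for i j
    using Pr_eq_diag[OF that(2,3)] that
    by (intro exI[of _ "if i \<le> j then j - i else j + (r + 1) - i"] exI[of _ j]) auto
  then show thesis using assms that by (force simp: H_verts_def)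
qed

lemma Pr_verts: "i \<in> {1..r + 1} \<Longrightarrow> j \<in> {1..r} \<Longrightarrow> Pr i j \<in> H_verts r"
  by (simp add: H_verts_def)

lemma diag_verts:
  assumes "c \<le> r" "x \<in> {1..r}"
  shows "diag r c x \<in> H_verts r"
  using assms unfolding diag_def by (intro Pr_verts) auto

lemma Sg_verts: "Sg i \<in> H_verts r \<longleftrightarrow> i \<le> r + 1"
  by (simp add: H_verts_def)

lemma last_verts: "Pr (r + 1) (r + 1) \<in> H_verts r"
  by (simp add: H_verts_def)

lemma edge_nbrs_diag:
  assumes "r > 2" "c \<le> r" "x \<in> {1..r}"
  shows "edge_nbrs r (diag r c x) = insert (tree_nbr r c x) (clique r c - {diag r c x})"
proof -
  define i where "i = (if c < x then x - c else x + (r + 1) - c)"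
  have i: "diag r c x = Pr i x" "i \<in> {1..r + 1}" "x = i + c \<or> x + (r + 1) = i + c"
    using assms by (auto simp: diag_def i_def)
  have "clique_of r i x = clique r c"
  proof (rule set_eqI)
    fix w show "w \<in> clique_of r i x \<longleftrightarrow> w \<in> clique r c"
    proof (cases w)
      case (Sg k)
      then show ?thesis by (simp add: clique_of_def)
    next
      case (Pr u v)
      show ?thesis unfolding Pr Pr_in_clique_iff[OF assms(2)] clique_of_def
        using i(2,3) assms by auto
    qed
  qed
  moreover have "(if i = r + 1 then Sg (r + 1) else if x = r then Pr (r + 1) (r + 1) else Sg i) =
      tree_nbr r c x"
    using i assms by (auto simp: tree_nbr_def diag_def split: if_splits)
  ultimately show ?thesis using assms(3) i(1) by auto
qed

lemma arc_head_diag: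
  assumes "r > 2" "c \<le> r" "x \<in> {1..r}"
  shows "arc_head r (diag r c x) = diag_arc r c x"
  using assms by (auto simp: diag_arc_def diag_def)

lemma tree_nbr_verts:
  "c \<le> r \<Longrightarrow> x \<in> {1..r} \<Longrightarrow> tree_nbr r c x \<in> H_verts r - clique r c"
  using last_verts[of r] by (auto simp: tree_nbr_def Sg_verts Pr_in_clique_iff)

lemma diag_arc_verts:
  assumes "r > 2" "c \<le> r" "x \<in> {1..r}"
  shows "diag_arc r c x \<in> H_verts r - clique r c"
  using assms by (auto simp: diag_arc_def Sg_verts Pr_in_clique_iff intro!: Pr_verts)

lemma tree_nbr_neq_diag_arc:
  assumes "r > 2" "c \<le> r" "x \<in> {1..r}"
  shows "tree_nbr r c x \<noteq> diag_arc r c x"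
  using assms by (auto simp: tree_nbr_def diag_arc_def)

section \<open>Order and regularity\<close>

lemma finite_H_verts: "finite (H_verts r)"
proof -
  have "H_verts r \<subseteq> Sg ` {..r + 1} \<union> (\<lambda>(i, j). Pr i j) ` ({..r + 1} \<times> {..r + 1})"
    by (auto simp: H_verts_def)
  then show ?thesis by (rule finite_subset) auto
qed

lemma card_H_verts: "card (H_verts r) = r^2 + 2 * r + 3"
proof -
  have "H_verts r = Sg ` {..r + 1} \<union>
      ((\<lambda>(i, j). Pr i j) ` ({1..r + 1} \<times> {1..r}) \<union> {Pr (r + 1) (r + 1)})"
    by (auto simp: H_verts_def)
  also have "card \<dots> = (r + 2) + (card ((\<lambda>(i, j). Pr i j) ` ({1..r + 1} \<times> {1..r})) + 1)"
    by (subst card_Un_disjoint card_image, (auto simp: inj_on_def)[3])+ (simp add: card_image inj_on_def)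
  also have "card ((\<lambda>(i, j). Pr i j) ` ({1..r + 1} \<times> {1..r})) = (r + 1) * r"
    by (subst card_image) (auto simp: inj_on_def)
  finally show ?thesis by (simp add: power2_eq_square)
qed

lemma verts_H_graph [simp]: "verts (H_graph r) = H_verts r"
  by (simp add: H_graph_def)

lemma H_mixed_graph:
  assumes "r > 2"
  shows "is_mixed_graph (H_graph r)"
proof -
  have "e \<subseteq> H_verts r \<and> card e = 2" if "e \<in> H_edges r" for e
    using that assms unfolding H_edges_def by (auto simp: H_verts_def card_insert_if)
  moreover have "arc_head r v \<in> H_verts r \<and> v \<noteq> arc_head r v" if "v \<in> H_verts r" for v
    using that
  proof (cases rule: H_verts_cases)
    case (1 i)
    then show ?thesis using assms by (auto simp: H_verts_def)
  next
    case 2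
    then show ?thesis using assms by (auto simp: H_verts_def)
  next
    case (3 c x)
    then have "diag_arc r c x \<in> H_verts r - clique r c" "diag r c x \<in> clique r c"
      using diag_arc_verts[OF assms] by (auto simp: clique_def)
    then show ?thesis using 3 arc_head_diag[OF assms] by auto
  qed
  moreover have "Sg 0 \<in> H_verts r" by (simp add: Sg_verts)
  ultimately show ?thesis
    using finite_H_verts unfolding is_mixed_graph_def by (auto simp: H_graph_def H_arcs_eq[OF assms])
qed

lemma H_adj_iff:
  assumes "r > 2" "v \<in> H_verts r"
  shows "mixed_adj (H_graph r) v w \<longleftrightarrow> w \<in> insert (arc_head r v) (edge_nbrs r v)"
  using assms H_edge_iff[OF assms] by (auto simp: mixed_adj_def H_graph_def H_arcs_eq)

lemma card_edge_nbrs: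
  assumes "r > 2" "v \<in> H_verts r"
  shows "card (edge_nbrs r v) = r"
  using assms(2)
proof (cases rule: H_verts_cases)
  case (1 i)
  have "card (Pr i ` {1..r - 1}) = r - 1" "Sg 0 \<notin> Pr i ` {1..r - 1}"
    by (auto simp: card_image inj_on_def)
  then show ?thesis using 1 assms by (auto simp: card_image inj_on_def)
next
  case 2
  then show ?thesis by (auto simp: card_image inj_on_def)
next
  case (3 c x)
  then have "diag r c x \<in> clique r c" by (auto simp: clique_def)
  then show ?thesis
    using 3 tree_nbr_verts[of c r x] assms(1)
    by (auto simp: edge_nbrs_diag card_clique)
qed

lemma arc_head_notin_edge_nbrs:
  assumes "r > 2" "v \<in> H_verts r"
  shows "arc_head r v \<notin> edge_nbrs r v \<and> v \<notin> edge_nbrs r v"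
  using assms(2)
proof (cases rule: H_verts_cases)
  case (1 i)
  then show ?thesis using assms by auto
next
  case 2
  then show ?thesis by auto
next
  case (3 c x)
  then have "diag r c x \<in> clique r c" by (auto simp: clique_def)
  then show ?thesis
    using 3 tree_nbr_verts[of c r x] diag_arc_verts[of r c x] tree_nbr_neq_diag_arc[of r c x] assms(1)
    by (auto simp: edge_nbrs_diag arc_head_diag)
qed

text \<open>
  Surjectivity is enough on a finite set.  It says that each vertex is the head of some arc, which
  is the in-degree condition.
\<close>

lemma arc_head_bij:
  assumes "r > 2"
  shows "bij_betw (arc_head r) (H_verts r) (H_verts r)"
proof -
  have im: "arc_head r ` H_verts r \<subseteq> H_verts r"
    using H_mixed_graph[OF assms] by (auto simp: is_mixed_graph_def H_graph_def H_arcs_eq[OF assms])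
  have "\<exists>v \<in> H_verts r. arc_head r v = w" if w: "w \<in> H_verts r" for w
  proof (cases w)
    case (Sg k)
    then consider "k = 0" | "k \<in> {1..r}" | "k = r + 1" using w by (force simp: H_verts_def)
    then show ?thesis
    proof cases
      case 1
      then show ?thesis using Sg last_verts by (intro bexI[of _ "Pr (r + 1) (r + 1)"]) auto
    next
      case 2
      then show ?thesis
        using Sg by (intro bexI[of _ "Pr (r + 1) (r + 1 - k)"] Pr_verts) auto
    next
      case 3
      then show ?thesis using Sg by (intro bexI[of _ "Sg 0"]) (auto simp: Sg_verts)
    qed
  next
    case (Pr u v)
    then consider "u = r + 1" "v = r + 1" | "u = r + 1" "v \<in> {1..r}" | "u \<in> {1..r}" "v = r"
      | "u = v" "v \<in> {1..<r}" | "u \<in> {1..r}" "v \<in> {1..<r}" "u \<noteq> v"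
      using w by (force simp: H_verts_def)
    then show ?thesis
    proof cases
      case 1
      then show ?thesis using Pr by (intro bexI[of _ "Sg (r + 1)"]) (auto simp: Sg_verts)
    next
      case 2
      then show ?thesis using Pr assms by (intro bexI[of _ "Pr (r + 1 - v) r"] Pr_verts) auto
    next
      case 3
      then show ?thesis using Pr by (intro bexI[of _ "Sg u"]) (auto simp: Sg_verts)
    next
      case 4
      then show ?thesis using Pr assms by (intro bexI[of _ "Pr (v + 1) v"] Pr_verts) auto
    next
      case 5
      then show ?thesis
        using Pr assms
        by (intro bexI[of _ "diag r (r - u) (r - v)"] diag_verts)
          (auto simp: arc_head_diag diag_arc_def)
    qed
  qed
  then have "arc_head r ` H_verts r = H_verts r" using im by blast
  then show ?thesis
    using finite_H_verts by (simp add: bij_betw_def eq_card_imp_inj_on)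
qed

lemma H_totally_regular:
  assumes "r > 2"
  shows "totally_regular (H_graph r) r 1"
proof -
  have "out_degree (H_graph r) v = 1" "in_degree (H_graph r) v = 1"
    and "undirected_degree (H_graph r) v = r" if v: "v \<in> H_verts r" for v
  proof -
    show "out_degree (H_graph r) v = 1" "in_degree (H_graph r) v = 1"
      using degrees_permutation_arcs[of "H_graph r" "arc_head r" v] v arc_head_bij[OF assms]
      by (auto simp: H_graph_def H_arcs_eq[OF assms])
    have "{w. {v, w} \<in> edges (H_graph r)} = edge_nbrs r v"
      using H_edge_iff[OF assms v] by (auto simp: H_graph_def)
    then show "undirected_degree (H_graph r) v = r"
      using undirected_degree_eq_card[OF H_mixed_graph[OF assms]] card_edge_nbrs[OF assms v] by simp
  qed
  then show ?thesis by (auto simp: totally_regular_def H_graph_def)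
qed

section \<open>Closed neighbourhoods\<close>

definition closed_nbrs :: "nat \<Rightarrow> H_vertex \<Rightarrow> H_vertex set" where
  "closed_nbrs r v = insert v (insert (arc_head r v) (edge_nbrs r v))"

lemma ball_Suc_H:
  assumes "r > 2" "v \<in> H_verts r"
  shows "ball (H_graph r) (Suc k) v = (\<Union>w \<in> ball (H_graph r) k v. closed_nbrs r w)"
proof -
  have "ball (H_graph r) k v \<subseteq> H_verts r"
    using ball_subset_verts[OF H_mixed_graph[OF assms(1)], of v k] assms(2) by (simp add: H_graph_def)
  then show ?thesis using H_adj_iff[OF assms(1)] by (auto simp: closed_nbrs_def subset_iff)
qed

lemma ball_1_H:
  assumes "r > 2" "v \<in> H_verts r"
  shows "ball (H_graph r) (Suc 0) v = closed_nbrs r v"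
  using ball_Suc_H[OF assms, of 0] by simp

text \<open>
  No two of the neighbours coincide: this is where the absence of an arc parallel to an edge enters.
\<close>

lemma card_closed_nbrs:
  assumes "r > 2" "v \<in> H_verts r"
  shows "card (closed_nbrs r v) = r + 2"
proof -
  have "finite (edge_nbrs r v)"
    using card_edge_nbrs[OF assms] assms(1) by (intro card_ge_0_finite) simp
  moreover have "arc_head r v \<noteq> v"
    using H_mixed_graph[OF assms(1)] assms(2)
    by (auto simp: is_mixed_graph_def H_graph_def H_arcs_eq[OF assms(1)])
  ultimately show ?thesis
    using arc_head_notin_edge_nbrs[OF assms] card_edge_nbrs[OF assms] by (simp add: closed_nbrs_def)
qed

lemma closed_nbrs_Sg_0: "r > 2 \<Longrightarrow> closed_nbrs r (Sg 0) = Sg ` {..r + 1}"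
  by (auto simp: closed_nbrs_def image_iff)

lemma closed_nbrs_Sg:
  assumes "i \<in> {1..r}"
  shows "closed_nbrs r (Sg i) = {Sg 0, Sg i} \<union> Pr i ` {1..r}"
  using assms by (force simp: closed_nbrs_def)

lemma closed_nbrs_Sg_last: "closed_nbrs r (Sg (r + 1)) = insert (Sg (r + 1)) (Pr (r + 1) ` {1..r + 1})"
  by (force simp: closed_nbrs_def)

lemma closed_nbrs_last:
  "closed_nbrs r (Pr (r + 1) (r + 1)) = {Sg 0, Pr (r + 1) (r + 1)} \<union> (\<lambda>i. Pr i r) ` {1..r}"
  by (auto simp: closed_nbrs_def)

lemma closed_nbrs_diag:
  assumes "r > 2" "c \<le> r" "x \<in> {1..r}"
  shows "closed_nbrs r (diag r c x) = {tree_nbr r c x, diag_arc r c x} \<union> clique r c"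
  using assms unfolding closed_nbrs_def
  by (auto simp: edge_nbrs_diag arc_head_diag) (auto simp: clique_def)

section \<open>Balls of radius two around the vertices of the cliques\<close>

lemma ball_2_H:
  assumes "r > 2" "v \<in> H_verts r"
  shows "ball (H_graph r) 2 v = (\<Union>w \<in> closed_nbrs r v. closed_nbrs r w)"
  using ball_Suc_H[OF assms, of "Suc 0"] ball_1_H[OF assms] by (simp only: numeral_2_eq_2)

text \<open>
  Two steps from a clique vertex either start inside the clique or leave it at once.
\<close>

lemma ball_2_diag:
  assumes "r > 2" "c \<le> r" "x \<in> {1..r}"
  shows "ball (H_graph r) 2 (diag r c x) =
    clique r c \<union> tree_nbr r c ` {1..r} \<union> diag_arc r c ` {1..r} \<union>
    closed_nbrs r (tree_nbr r c x) \<union> closed_nbrs r (diag_arc r c x)"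
proof -
  have "(\<Union>w \<in> clique r c. closed_nbrs r w) =
      clique r c \<union> tree_nbr r c ` {1..r} \<union> diag_arc r c ` {1..r}"
    using assms by (auto simp: clique_def closed_nbrs_diag)
  then show ?thesis
    using assms by (simp add: ball_2_H diag_verts closed_nbrs_diag[OF assms]) blast
qed

lemma Sg_in_image [simp]: "Sg k \<in> Sg ` A \<longleftrightarrow> k \<in> A" "Sg k \<notin> Pr i ` B"
  by auto

lemma Pr_in_image [simp]: "Pr u v \<in> Pr i ` A \<longleftrightarrow> u = i \<and> v \<in> A" "Pr u v \<notin> Sg ` B"
  by auto

lemma Sg_set_eqI:
  assumes "\<And>k. Sg k \<in> A \<longleftrightarrow> Sg k \<in> B" "\<And>u v. Pr u v \<notin> A" "\<And>u v. Pr u v \<notin> B"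
  shows "A = B"
proof (rule set_eqI)
  fix w show "w \<in> A \<longleftrightarrow> w \<in> B" using assms by (cases w) auto
qed

lemma image_tree_nbr:
  assumes "r > 2" "c < r"
  shows "tree_nbr r c ` {1..r} =
    insert (Pr (r + 1) (r + 1)) (Sg ` ({1..r + 1} - {r - c, r + 1 - c}))"
proof (intro equalityI subsetI)
  fix w assume "w \<in> tree_nbr r c ` {1..r}"
  then show "w \<in> insert (Pr (r + 1) (r + 1)) (Sg ` ({1..r + 1} - {r - c, r + 1 - c}))"
    using assms by (auto simp: tree_nbr_def split: if_splits)
next
  fix w assume "w \<in> insert (Pr (r + 1) (r + 1)) (Sg ` ({1..r + 1} - {r - c, r + 1 - c}))"
  then consider "w = Pr (r + 1) (r + 1)"
    | k where "w = Sg k" "k \<in> {1..r + 1}" "k \<noteq> r - c" "k \<noteq> r + 1 - c" by blast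
  then show "w \<in> tree_nbr r c ` {1..r}"
  proof cases
    case 1
    then show ?thesis using assms by (intro image_eqI[of _ _ r]) (auto simp: tree_nbr_def)
  next
    case 2
    then show ?thesis
      using assms
      by (intro image_eqI[of _ _ "if k + c \<le> r then k + c else k + c - (r + 1)"])
        (auto simp: tree_nbr_def)
  qed
qed

lemma image_tree_nbr_last:
  assumes "r > 2"
  shows "tree_nbr r r ` {1..r} = Sg ` {2..r + 1}"
proof -
  have "tree_nbr r r ` {1..r} = (\<lambda>x. Sg (Suc x)) ` {1..r}"
    by (intro image_cong) (auto simp: tree_nbr_def)
  also have "\<dots> = Sg ` Suc ` {1..r}" by (simp only: image_image)
  also have "Suc ` {1..r} = {2..r + 1}"
    by (simp only: image_Suc_atLeastAtMost) (simp add: numeral_2_eq_2)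
  finally show ?thesis .
qed

text \<open>
  The heads fill row \<open>r - c\<close> in the columns \<open>1, \<dots>, r - 1\<close>, except for column \<open>r - c\<close>: it would
  correspond to column \<open>c\<close>, whose arc goes to some \<open>Sg k\<close> instead.  The arc from column \<open>r\<close> ends in row \<open>r + 1\<close>.
\<close>

lemma image_diag_arc:
  assumes "r > 2" "c < r"
  shows "diag_arc r c ` {1..r} =
    (if c = 0 then {} else {Sg (r + 1 - c)}) \<union>
    {Pr (r + 1) (c + 1)} \<union> Pr (r - c) ` ({1..r - 1} - {r - c})"
proof (intro equalityI subsetI)
  fix w assume "w \<in> diag_arc r c ` {1..r}"
  then show "w \<in> (if c = 0 then {} else {Sg (r + 1 - c)}) \<union>
    {Pr (r + 1) (c + 1)} \<union> Pr (r - c) ` ({1..r - 1} - {r - c})"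
    using assms by (auto simp: diag_arc_def)
next
  fix w assume "w \<in> (if c = 0 then {} else {Sg (r + 1 - c)}) \<union>
    {Pr (r + 1) (c + 1)} \<union> Pr (r - c) ` ({1..r - 1} - {r - c})"
  then consider "c \<noteq> 0" "w = Sg (r + 1 - c)" | "w = Pr (r + 1) (c + 1)"
    | y where "w = Pr (r - c) y" "y \<in> {1..r - 1}" "y \<noteq> r - c"
    by (cases "c = 0") (simp_all only: if_True if_False simp_thms, blast+)
  then show "w \<in> diag_arc r c ` {1..r}"
  proof cases
    case 1
    then show ?thesis using assms by (intro image_eqI[of _ _ c]) (auto simp: diag_arc_def)
  next
    case 2
    then show ?thesis using assms by (intro image_eqI[of _ _ r]) (auto simp: diag_arc_def)
  next
    case 3
    then show ?thesis using assms by (intro image_eqI[of _ _ "r - y"]) (auto simp: diag_arc_def)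
  qed
qed

lemma image_diag_arc_last:
  assumes "r > 2"
  shows "diag_arc r r ` {1..r} = insert (Sg 1) ((\<lambda>x. Pr x x) ` {1..r - 1})"
proof -
  have "{1..r} = insert r {1..r - 1}" using assms by auto
  then show ?thesis using assms by (auto simp: diag_arc_def)
qed

lemma card_Un_eq:
  "card A = a \<Longrightarrow> card B = b \<Longrightarrow> finite A \<Longrightarrow> finite B \<Longrightarrow> A \<inter> B = {} \<Longrightarrow> card (A \<union> B) = a + b"
  by (simp add: card_Un_disjoint)

lemma card_image_Pr [simp]: "card (Pr i ` A) = card A"
  by (simp add: card_image inj_on_def)

lemma card_image_Sg [simp]: "card (Sg ` A) = card A"
  by (simp add: card_image inj_on_def)

text \<open>
  Here \<open>i\<close> is the row, so the tree neighbour is \<open>Sg i\<close>, and the arc leads to the clique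
  \<open>r + 1 - i\<close>.  The last vertex listed is the one reached by two successive arcs.  The vertices
  \<open>Sg k\<close> are all reached: of those that are not tree neighbours of the clique,
  \<open>k = 0\<close> is adjacent to \<open>Sg i\<close>, \<open>k = r + 1 - c\<close> is an arc head, and \<open>k = r - c\<close> is
  the tree neighbour of the arc head of \<open>(i, x)\<close>.  Only for \<open>c = 0\<close>, where row \<open>r + 1\<close> does
  not occur, \<open>Sg (r + 1)\<close> is out of reach.
\<close>

lemma ball_2_generic:
  assumes "r > 2" "c < r" "x \<in> {1..<r}" "i \<in> {1..r}" "x = i + c \<or> x + (r + 1) = i + c"
  shows "ball (H_graph r) 2 (diag r c x) =
    Sg ` {..if c = 0 then r else r + 1} \<union> {Pr (r + 1) (r + 1), Pr (r + 1) (c + 1)} \<union>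
    clique r c \<union> clique r (r + 1 - i) \<union> Pr i ` ({1..r} - {x}) \<union>
    Pr (r - c) ` ({1..r - 1} - {r - c, r - x}) \<union>
    {if i = 1 then Pr (r - x) (r - x) else Pr (i - 1) x}"
proof -
  have d: "diag r c x = Pr i x" using assms by (auto simp: diag_def)
  have xi: "Pr i x \<in> clique r c" using assms by (auto simp: Pr_in_clique_iff)
  have t: "tree_nbr r c x = Sg i" using assms by (auto simp: tree_nbr_def)
  have a: "diag_arc r c x = diag r (r + 1 - i) (r - x)"
    using assms by (auto simp: diag_arc_def diag_def)
  have ta: "tree_nbr r (r + 1 - i) (r - x) = Sg (r - c)"
    using assms by (auto simp: tree_nbr_def)
  have aa: "diag_arc r (r + 1 - i) (r - x) = (if i = 1 then Pr (r - x) (r - x) else Pr (i - 1) x)"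
    using assms by (auto simp: diag_arc_def)
  have tin: "Pr (r - c) (r - x) \<in> clique r (r + 1 - i)"
    using assms by (subst Pr_in_clique_iff) auto
  have "r + 1 - i \<le> r" "r - x \<in> {1..r}" "x \<in> {1..r}" using assms by auto
  then have "ball (H_graph r) 2 (diag r c x) =
    clique r c \<union> insert (Pr (r + 1) (r + 1)) (Sg ` ({1..r + 1} - {r - c, r + 1 - c})) \<union>
    ((if c = 0 then {} else {Sg (r + 1 - c)}) \<union>
    {Pr (r + 1) (c + 1)} \<union> Pr (r - c) ` ({1..r - 1} - {r - c})) \<union>
    ({Sg 0, Sg i} \<union> Pr i ` {1..r}) \<union>
    ({Sg (r - c), if i = 1 then Pr (r - x) (r - x) else Pr (i - 1) x} \<union> clique r (r + 1 - i))"
    using assms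
    by (simp only: ball_2_diag less_imp_le image_tree_nbr image_diag_arc t a closed_nbrs_Sg
        closed_nbrs_diag ta aa)
  also have "\<dots> = (Sg ` ({1..r + 1} - {r - c, r + 1 - c}) \<union> {Sg 0, Sg i, Sg (r - c)} \<union>
      (if c = 0 then {} else {Sg (r + 1 - c)})) \<union>
    {Pr (r + 1) (r + 1), Pr (r + 1) (c + 1)} \<union>
    clique r c \<union> clique r (r + 1 - i) \<union> Pr i ` ({1..r} - {x}) \<union>
    Pr (r - c) ` ({1..r - 1} - {r - c, r - x}) \<union>
    {if i = 1 then Pr (r - x) (r - x) else Pr (i - 1) x}"
  proof -
    have "Pr i ` {1..r} = insert (Pr i x) (Pr i ` ({1..r} - {x}))" using assms by auto
    moreover have "Pr (r - c) ` ({1..r - 1} - {r - c}) =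
        insert (Pr (r - c) (r - x)) (Pr (r - c) ` ({1..r - 1} - {r - c, r - x}))"
      using assms by auto
    ultimately show ?thesis using xi tin by (simp only:) blast
  qed
  also have "Sg ` ({1..r + 1} - {r - c, r + 1 - c}) \<union> {Sg 0, Sg i, Sg (r - c)} \<union>
      (if c = 0 then {} else {Sg (r + 1 - c)}) = Sg ` {..if c = 0 then r else r + 1}"
    using assms by (cases "c = 0"; intro Sg_set_eqI) auto
  finally show ?thesis .
qed

text \<open>
  All pieces of the ball are disjoint, except that the vertex after two arcs may already have been
  counted.  In a row \<open>i > 1\<close> it is \<open>(i - 1, x)\<close>, which none of the pieces contains.  In row \<open>1\<close>, where
  \<open>x = c + 1\<close>, it is \<open>(r - x, r - x)\<close>.  This vertex belongs to clique \<open>0\<close>, which has been counted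
  if \<open>c = 0\<close>, and it lies in row \<open>1\<close> itself if \<open>x = r - 1\<close>.  The case \<open>c = 0\<close> has one vertex \<open>Sg k\<close> less and one arc head more than the
  others.
\<close>

lemma card_ball_2_generic:
  assumes "r > 2" "c < r" "x \<in> {1..<r}" "x \<noteq> c"
  shows "card (ball (H_graph r) 2 (diag r c x)) =
    (if x = c + 1 \<and> (c = 0 \<or> c = r - 2) then 5 * r else 5 * r + 1)"
proof -
  define i where "i = (if c < x then x - c else x + (r + 1) - c)"
  have i: "i \<in> {1..r}" "x = i + c \<or> x + (r + 1) = i + c" using assms by (auto simp: i_def)
  define e where "e = (if i = 1 then Pr (r - x) (r - x) else Pr (i - 1) x)"
  define A where "A = Sg ` {..if c = 0 then r else r + 1} \<union>
    {Pr (r + 1) (r + 1), Pr (r + 1) (c + 1)} \<union>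
    clique r c \<union> clique r (r + 1 - i) \<union> Pr i ` ({1..r} - {x}) \<union>
    Pr (r - c) ` ({1..r - 1} - {r - c, r - x})"
  have row: "card ({1..r - 1} - {r - c, r - x}) = (if c = 0 then r - 2 else r - 3)"
  proof (cases "c = 0")
    case True
    then have "{1..r - 1} - {r - c, r - x} = {1..r - 1} - {r - x}" by auto
    moreover have "r - x \<in> {1..r - 1}" using assms by auto
    ultimately show ?thesis using True by (simp add: card_Diff_singleton)
  next
    case False
    then have "{r - c, r - x} \<subseteq> {1..r - 1}" "r - c \<noteq> r - x" using assms by auto
    then show ?thesis using False by (subst card_Diff_subset) (auto simp: card_insert_if)
  qed
  let ?S = "Sg ` {..if c = 0 then r else r + 1}" and ?L = "{Pr (r + 1) (r + 1), Pr (r + 1) (c + 1)}"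
    and ?R = "Pr i ` ({1..r} - {x})" and ?T = "Pr (r - c) ` ({1..r - 1} - {r - c, r - x})"
  define d where "d = r + 1 - i"
  have d: "i + d = r + 1" "d \<le> r" "1 \<le> d" using i by (auto simp: d_def)
  have le: "c \<le> r" "d \<le> r" using assms d by auto
  note in_clique = Pr_in_clique_iff[OF le(1)] Pr_in_clique_iff[OF le(2)]
  have 1: "?L \<inter> clique r c = {}" using assms by (auto simp: in_clique)
  have 2: "?L \<inter> clique r (d) = {}" using assms(1-4) i d by (auto simp: in_clique)
  have 3: "clique r c \<inter> clique r (d) = {}"
  proof -
    have "c \<noteq> d" using assms(1-4) i d by auto
    then show ?thesis using le by (auto simp: clique_def diag_inject)
  qed
  have 4: "?L \<inter> ?R = {}" using i by auto
  have 5: "clique r c \<inter> ?R = {}" using i assms(2,3) by (auto simp: in_clique)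
  have 6: "clique r (d) \<inter> ?R = {}" using i d by (auto simp: in_clique)
  have 7: "?L \<inter> ?T = {}" using i by auto
  have 8: "clique r c \<inter> ?T = {}" using i assms(2,3) by (auto simp: in_clique)
  have 9: "clique r (d) \<inter> ?T = {}" 
  proof -
    have "Pr (r - c) y \<notin> clique r d" if "y \<in> {1..r - 1}" "y \<noteq> r - x" for y
      using i d assms(2,3) that unfolding in_clique by auto
    then show ?thesis by blast
  qed
  have 10: "?R \<inter> ?T = {}"
  proof -
    have "i \<noteq> r - c" using i assms(2,3) by auto
    then show ?thesis by auto
  qed
  have c: "card ?L = 2" "card ?R = r - 1" "card ?S = (if c = 0 then r + 1 else r + 2)"
    "card ?T = (if c = 0 then r - 2 else r - 3)"
    using assms row by auto
  have S: "?S \<inter> ?L = {}" "?S \<inter> clique r k = {}" "?S \<inter> ?R = {}" "?S \<inter> ?T = {}" for k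
    by auto
  have fin: "finite ?S" "finite ?L" "finite ?R" "finite ?T" by simp_all
  have "card A = (if c = 0 then r + 1 else r + 2) + 2 + r + r + (r - 1) +
      (if c = 0 then r - 2 else r - 3)"
    unfolding A_def d_def[symmetric]
    by (intro card_Un_eq card_clique c finite_UnI finite_clique fin;
        simp only: Int_Un_distrib2 S 1 2 3 4 5 6 7 8 9 10 Un_empty)
  moreover have "e \<in> A \<longleftrightarrow> x = c + 1 \<and> (c = 0 \<or> c = r - 2)"
  proof -
    have A: "A = ?S \<union> ?L \<union> clique r c \<union> clique r d \<union> ?R \<union> ?T"
      by (simp only: A_def d_def)
    show ?thesis
    proof (cases "i = 1")
      case True
      then have x: "x = c + 1" "d = r" using i d assms by auto
      have e: "e = Pr (r - x) (r - x)" using True by (simp add: e_def)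
      have "Pr (r - x) (r - x) \<in> clique r c \<longleftrightarrow> c = 0" "Pr (r - x) (r - x) \<notin> clique r d"
        using x assms unfolding in_clique by auto
      moreover have "Pr (r - x) (r - x) \<in> ?R \<longleftrightarrow> c = r - 2" "Pr (r - x) (r - x) \<notin> ?T"
        "Pr (r - x) (r - x) \<notin> ?S" "Pr (r - x) (r - x) \<notin> ?L"
        using True x assms by auto
      ultimately show ?thesis unfolding A e Un_iff using x(1) by blast
    next
      case False
      then have x: "x \<noteq> c + 1" using i assms by auto
      have e: "e = Pr (i - 1) x" using False by (simp add: e_def)
      have "Pr (i - 1) x \<notin> clique r c" "Pr (i - 1) x \<notin> clique r d"
        using False i d assms unfolding in_clique by auto
      moreover have "Pr (i - 1) x \<notin> ?S" "Pr (i - 1) x \<notin> ?L" "Pr (i - 1) x \<notin> ?R" "Pr (i - 1) x \<notin> ?T"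
        using False i assms by auto
      ultimately show ?thesis unfolding A e Un_iff using x by blast
    qed
  qed
  moreover have "ball (H_graph r) 2 (diag r c x) = insert e A"
    using ball_2_generic[OF assms(1-3) i] by (simp add: A_def e_def)
  moreover have "finite A" by (simp add: A_def)
  ultimately show ?thesis using assms by (auto simp: card_insert_if)
qed

text \<open>
  The arcs leaving clique \<open>r\<close> by rule (7) all end in clique \<open>0\<close>, which the ball contains anyway, and no member of
  clique \<open>r\<close> is adjacent to \<open>(r + 1, r + 1)\<close>.  This makes these balls smaller by about \<open>r\<close>.
\<close>

lemma ball_2_last_clique:
  assumes "r > 2" "x \<in> {1..<r}"
  shows "ball (H_graph r) 2 (diag r r x) =
    Sg ` {..r + 1} \<union> clique r r \<union> clique r 0 \<union> Pr (x + 1) ` ({1..r} - {x, x + 1}) \<union>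
    {Pr r (r - x)}"
proof -
  have x: "x \<in> {1..r}" "x + 1 \<in> {1..r}" using assms by auto
  have t: "tree_nbr r r x = Sg (x + 1)" "tree_nbr r 0 x = Sg x"
    using assms by (auto simp: tree_nbr_def)
  have a: "diag_arc r r x = diag r 0 x" "diag_arc r 0 x = Pr r (r - x)"
    using assms by (auto simp: diag_arc_def diag_def)
  have in0: "(\<lambda>y. Pr y y) ` {1..r - 1} \<subseteq> clique r 0" by (auto simp: Pr_in_clique_iff)
  have "ball (H_graph r) 2 (diag r r x) =
    clique r r \<union> Sg ` {2..r + 1} \<union> insert (Sg 1) ((\<lambda>x. Pr x x) ` {1..r - 1}) \<union>
    ({Sg 0, Sg (x + 1)} \<union> Pr (x + 1) ` {1..r}) \<union> ({Sg x, Pr r (r - x)} \<union> clique r 0)"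
    by (simp only: ball_2_diag[OF assms(1) order_refl x(1)] image_tree_nbr_last[OF assms(1)]
        image_diag_arc_last[OF assms(1)] t a closed_nbrs_Sg[OF x(2)]
        closed_nbrs_diag[OF assms(1) _ x(1)] le0)
  also have "\<dots> = (Sg ` {2..r + 1} \<union> {Sg 1, Sg 0, Sg (x + 1), Sg x}) \<union> clique r r \<union> clique r 0 \<union>
      Pr (x + 1) ` ({1..r} - {x, x + 1}) \<union> {Pr r (r - x)}"
  proof -
    have "Pr (x + 1) ` {1..r} =
        insert (Pr (x + 1) x) (insert (Pr (x + 1) (x + 1)) (Pr (x + 1) ` ({1..r} - {x, x + 1})))"
      using assms by auto
    moreover have "Pr (x + 1) x \<in> clique r r" "Pr (x + 1) (x + 1) \<in> clique r 0"
      using assms by (auto simp: Pr_in_clique_iff)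
    ultimately show ?thesis using in0 by (simp only:) blast
  qed
  also have "Sg ` {2..r + 1} \<union> {Sg 1, Sg 0, Sg (x + 1), Sg x} = Sg ` {..r + 1}"
    using assms by (intro Sg_set_eqI) auto
  finally show ?thesis .
qed

lemma card_ball_2_last_clique:
  assumes "r > 2" "x \<in> {1..<r}"
  shows "card (ball (H_graph r) 2 (diag r r x)) =
    (if x = 1 \<or> x = r - 1 then 4 * r else 4 * r + 1)"
proof -
  define A where "A = Sg ` {..r + 1} \<union> clique r r \<union> clique r 0 \<union>
    Pr (x + 1) ` ({1..r} - {x, x + 1})"
  have row: "card ({1..r} - {x, x + 1}) = r - 2"
    using assms by (subst card_Diff_subset) auto
  have "card A = r + 2 + r + r + (r - 2)"
    unfolding A_def
    by (intro card_Un_eq card_clique; use assms row in \<open>auto simp: Pr_in_clique_iff\<close>)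
      (auto simp: clique_def diag_def split: if_splits)
  moreover have "Pr r (r - x) \<in> A \<longleftrightarrow> x = 1 \<or> x = r - 1"
    using assms by (auto simp: A_def Pr_in_clique_iff)
  moreover have "ball (H_graph r) 2 (diag r r x) = insert (Pr r (r - x)) A"
    using ball_2_last_clique[OF assms] by (simp add: A_def)
  moreover have "finite A" by (simp add: A_def)
  ultimately show ?thesis using assms(1) by (auto simp: card_insert_if)
qed

text \<open>
  In row \<open>r + 1\<close> the arc leads back to a vertex \<open>Sg k\<close>.  In place of a second clique the
  ball contains the two rows that are adjacent to \<open>Sg (r + 1)\<close> and \<open>Sg (r + 1 - c)\<close>.
\<close>

lemma ball_2_last_row:
  assumes "r > 2" "c \<in> {1..<r}"
  shows "ball (H_graph r) 2 (diag r c c) =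
    Sg ` ({..r + 1} - {r - c}) \<union> clique r c \<union> Pr (r + 1) ` ({1..r + 1} - {c}) \<union>
    Pr (r + 1 - c) ` {1..r} \<union> Pr (r - c) ` ({1..r - 1} - {r - c})"
proof -
  have c: "c < r" "c \<le> r" "c \<in> {1..r}" "r + 1 - c \<in> {1..r}" "c \<noteq> 0" using assms by auto
  have t: "tree_nbr r c c = Sg (r + 1)" by (simp add: tree_nbr_def)
  have a: "diag_arc r c c = Sg (r + 1 - c)" by (simp add: diag_arc_def)
  have "ball (H_graph r) 2 (diag r c c) =
    clique r c \<union> insert (Pr (r + 1) (r + 1)) (Sg ` ({1..r + 1} - {r - c, r + 1 - c})) \<union>
    ({Sg (r + 1 - c)} \<union> {Pr (r + 1) (c + 1)} \<union> Pr (r - c) ` ({1..r - 1} - {r - c})) \<union>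
    insert (Sg (r + 1)) (Pr (r + 1) ` {1..r + 1}) \<union>
    ({Sg 0, Sg (r + 1 - c)} \<union> Pr (r + 1 - c) ` {1..r})"
    by (simp only: ball_2_diag[OF assms(1) c(2,3)] image_tree_nbr[OF assms(1) c(1)]
        image_diag_arc[OF assms(1) c(1)] t a closed_nbrs_Sg[OF c(4)] closed_nbrs_Sg_last
        c(5) if_False)
  also have "\<dots> = (Sg ` ({1..r + 1} - {r - c, r + 1 - c}) \<union> {Sg 0, Sg (r + 1), Sg (r + 1 - c)}) \<union>
    clique r c \<union> Pr (r + 1) ` ({1..r + 1} - {c}) \<union>
    Pr (r + 1 - c) ` {1..r} \<union> Pr (r - c) ` ({1..r - 1} - {r - c})"
  proof -
    have "Pr (r + 1) ` {1..r + 1} = insert (Pr (r + 1) c) (Pr (r + 1) ` ({1..r + 1} - {c}))"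
      using assms by auto
    moreover have "Pr (r + 1) (r + 1) \<in> Pr (r + 1) ` ({1..r + 1} - {c})"
      "Pr (r + 1) (c + 1) \<in> Pr (r + 1) ` ({1..r + 1} - {c})"
      "Pr (r + 1) c \<in> clique r c"
      using assms by (auto simp: Pr_in_clique_iff)
    ultimately show ?thesis by (simp only:) blast
  qed
  also have "Sg ` ({1..r + 1} - {r - c, r + 1 - c}) \<union> {Sg 0, Sg (r + 1), Sg (r + 1 - c)} =
      Sg ` ({..r + 1} - {r - c})"
    using assms by (intro Sg_set_eqI) auto
  finally show ?thesis .
qed

lemma card_ball_2_last_row:
  assumes "r > 2" "c \<in> {1..<r}"
  shows "card (ball (H_graph r) 2 (diag r c c)) = 5 * r - 1"
proof -
  have "card ({1..r - 1} - {r - c}) = r - 2"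
    using assms by (subst card_Diff_subset) auto
  moreover have "card ({..r + 1} - {r - c}) = r + 1" "card ({1..r + 1} - {c}) = r"
    using assms by (auto simp: card_Diff_subset)
  ultimately have "card (ball (H_graph r) 2 (diag r c c)) = (r + 1) + r + r + r + (r - 2)"
    unfolding ball_2_last_row[OF assms]
    by (intro card_Un_eq card_clique; use assms in \<open>auto simp: Pr_in_clique_iff\<close>)
  then show ?thesis using assms by simp
qed

text \<open>
  As in the rest of row \<open>r + 1\<close>, but the arc heads of clique \<open>r\<close> form the main diagonal instead of a
  row; its first vertex \<open>(1, 1)\<close> is already in row \<open>1\<close>.
\<close>

lemma ball_2_corner:
  assumes "r > 2"
  shows "ball (H_graph r) 2 (diag r r r) =
    Sg ` {..r + 1} \<union> clique r r \<union> Pr (r + 1) ` ({1..r + 1} - {r}) \<union>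
    Pr 1 ` {1..r} \<union> (\<lambda>x. Pr x x) ` {2..r - 1}"
proof -
  have rr: "r \<in> {1..r}" "1 \<in> {1..r}" using assms by auto
  have t: "tree_nbr r r r = Sg (r + 1)" by (simp add: tree_nbr_def)
  have a: "diag_arc r r r = Sg 1" by (simp add: diag_arc_def)
  have "ball (H_graph r) 2 (diag r r r) =
    clique r r \<union> Sg ` {2..r + 1} \<union> insert (Sg 1) ((\<lambda>x. Pr x x) ` {1..r - 1}) \<union>
    insert (Sg (r + 1)) (Pr (r + 1) ` {1..r + 1}) \<union> ({Sg 0, Sg 1} \<union> Pr 1 ` {1..r})"
    by (simp only: ball_2_diag[OF assms order_refl rr(1)] image_tree_nbr_last[OF assms]
        image_diag_arc_last[OF assms] t a closed_nbrs_Sg[OF rr(2)] closed_nbrs_Sg_last)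
  also have "\<dots> = (Sg ` {2..r + 1} \<union> {Sg 0, Sg 1, Sg (r + 1)}) \<union>
    clique r r \<union> Pr (r + 1) ` ({1..r + 1} - {r}) \<union>
    Pr 1 ` {1..r} \<union> (\<lambda>x. Pr x x) ` {2..r - 1}"
  proof -
    have "Pr (r + 1) ` {1..r + 1} = insert (Pr (r + 1) r) (Pr (r + 1) ` ({1..r + 1} - {r}))"
      using assms by auto
    moreover have "Pr (r + 1) r \<in> clique r r" "Pr 1 1 \<in> Pr 1 ` {1..r}"
      using assms by (auto simp: Pr_in_clique_iff)
    moreover have "{1..r - 1} = insert 1 {2..r - 1}" using assms by auto
    then have "(\<lambda>x. Pr x x) ` {1..r - 1} = insert (Pr 1 1) ((\<lambda>x. Pr x x) ` {2..r - 1})"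
      by simp
    ultimately show ?thesis by (simp only:) blast
  qed
  also have "Sg ` {2..r + 1} \<union> {Sg 0, Sg 1, Sg (r + 1)} = Sg ` {..r + 1}"
    by (intro Sg_set_eqI) auto
  finally show ?thesis .
qed

lemma card_ball_2_corner:
  assumes "r > 2"
  shows "card (ball (H_graph r) 2 (diag r r r)) = 5 * r"
proof -
  have "card ({1..r + 1} - {r}) = r"
    using assms by (subst card_Diff_subset) auto
  moreover have "card ((\<lambda>x. Pr x x) ` {2..r - 1}) = r - 2"
    by (subst card_image) (auto simp: inj_on_def)
  ultimately have "card (ball (H_graph r) 2 (diag r r r)) = (r + 2) + r + r + r + (r - 2)"
    unfolding ball_2_corner[OF assms]
    by (intro card_Un_eq card_clique; use assms in \<open>auto simp: Pr_in_clique_iff\<close>)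
  then show ?thesis using assms by simp
qed

text \<open>
  The neighbourhood of the tree neighbour \<open>(r + 1, r + 1)\<close> is the last column with \<open>Sg 0\<close>, and the arc leads to
  the next clique \<open>c + 1\<close>.  The rows \<open>r - c\<close> and \<open>r - (c + 1)\<close> are removed from the column because their vertices there belong
  to these two cliques.
\<close>

lemma ball_2_last_column:
  assumes "r > 2" "c < r"
  shows "ball (H_graph r) 2 (diag r c r) =
    Sg ` {..r + 1} \<union> {Pr (r + 1) (r + 1)} \<union> clique r c \<union> clique r (c + 1) \<union>
    Pr (r - c) ` ({1..r - 1} - {r - c}) \<union> (\<lambda>i. Pr i r) ` ({1..r} - {r - c, r - (c + 1)})"
proof -
  have c: "c \<le> r" "r \<in> {1..r}" "c + 1 \<le> r" "c + 1 \<in> {1..r}" using assms by auto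
  have t: "tree_nbr r c r = Pr (r + 1) (r + 1)" "tree_nbr r (c + 1) (c + 1) = Sg (r + 1)"
    using assms by (auto simp: tree_nbr_def)
  have a: "diag_arc r c r = diag r (c + 1) (c + 1)" "diag_arc r (c + 1) (c + 1) = Sg (r - c)"
    using assms by (auto simp: diag_arc_def diag_def)
  have "ball (H_graph r) 2 (diag r c r) =
    clique r c \<union> insert (Pr (r + 1) (r + 1)) (Sg ` ({1..r + 1} - {r - c, r + 1 - c})) \<union>
    ((if c = 0 then {} else {Sg (r + 1 - c)}) \<union>
    {Pr (r + 1) (c + 1)} \<union> Pr (r - c) ` ({1..r - 1} - {r - c})) \<union>
    ({Sg 0, Pr (r + 1) (r + 1)} \<union> (\<lambda>i. Pr i r) ` {1..r}) \<union>
    ({Sg (r + 1), Sg (r - c)} \<union> clique r (c + 1))"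
    by (simp only: ball_2_diag[OF assms(1) c(1,2)] image_tree_nbr[OF assms]
        image_diag_arc[OF assms] t a closed_nbrs_last closed_nbrs_diag[OF assms(1) c(3,4)])
  also have "\<dots> = (Sg ` ({1..r + 1} - {r - c, r + 1 - c}) \<union>
      (if c = 0 then {} else {Sg (r + 1 - c)}) \<union> {Sg 0, Sg (r + 1), Sg (r - c)}) \<union>
    {Pr (r + 1) (r + 1)} \<union> clique r c \<union> clique r (c + 1) \<union>
    Pr (r - c) ` ({1..r - 1} - {r - c}) \<union> (\<lambda>i. Pr i r) ` ({1..r} - {r - c, r - (c + 1)})"
  proof -
    have "Pr (r - c) r \<in> clique r c" "Pr (r + 1) (c + 1) \<in> clique r (c + 1)"
      using assms by (auto simp: Pr_in_clique_iff)
    moreover have "c + 1 < r \<Longrightarrow> Pr (r - (c + 1)) r \<in> clique r (c + 1)"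
      by (auto simp: Pr_in_clique_iff)
    then have "(\<lambda>i. Pr i r) ` {1..r} \<subseteq> (\<lambda>i. Pr i r) ` ({1..r} - {r - c, r - (c + 1)}) \<union>
        {Pr (r - c) r} \<union> clique r (c + 1)"
    proof (intro image_subsetI)
      fix i assume "i \<in> {1..r}"
      then consider "i = r - c" | "i = r - (c + 1)" "c + 1 < r"
        | "i \<in> {1..r} - {r - c, r - (c + 1)}" by fastforce
      then show "Pr i r \<in> (\<lambda>i. Pr i r) ` ({1..r} - {r - c, r - (c + 1)}) \<union>
          {Pr (r - c) r} \<union> clique r (c + 1)"
        using \<open>c + 1 < r \<Longrightarrow> Pr (r - (c + 1)) r \<in> clique r (c + 1)\<close> by cases blast+
    qed
    moreover have "(\<lambda>i. Pr i r) ` ({1..r} - {r - c, r - (c + 1)}) \<subseteq> (\<lambda>i. Pr i r) ` {1..r}" by auto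
    ultimately show ?thesis by blast
  qed
  also have "Sg ` ({1..r + 1} - {r - c, r + 1 - c}) \<union>
      (if c = 0 then {} else {Sg (r + 1 - c)}) \<union> {Sg 0, Sg (r + 1), Sg (r - c)} = Sg ` {..r + 1}"
    using assms by (intro Sg_set_eqI) auto
  finally show ?thesis .
qed

text \<open>
  The two boundary cases gain one vertex each.  For \<open>c = 0\<close> no column is missing among the arc heads,
  as there is no vertex in row \<open>r + 1\<close>; for \<open>c = r - 1\<close> the member of clique \<open>r\<close> in column
  \<open>r\<close> lies in row \<open>r + 1\<close>, which does not belong to the neighbourhood of \<open>(r + 1, r + 1)\<close>.
\<close>

lemma card_ball_2_last_column:
  assumes "r > 2" "c < r"
  shows "card (ball (H_graph r) 2 (diag r c r)) = (if c = 0 \<or> c = r - 1 then 5 * r else 5 * r - 1)"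
proof -
  have row: "card ({1..r - 1} - {r - c}) = (if c = 0 then r - 1 else r - 2)"
  proof (cases "c = 0")
    case False
    then have "r - c \<in> {1..r - 1}" using assms by auto
    then show ?thesis using False by (simp add: card_Diff_singleton)
  next
    case True
    then have "{1..r - 1} - {r - c} = {1..r - 1}" using assms by auto
    then show ?thesis using True by simp
  qed
  have col: "card ((\<lambda>i. Pr i r) ` ({1..r} - {r - c, r - (c + 1)})) = (if c = r - 1 then r - 1 else r - 2)"
  proof (cases "c = r - 1")
    case True
    then have "{1..r} - {r - c, r - (c + 1)} = {1..r} - {1}" using assms by auto
    then show ?thesis using True assms by (subst card_image) (auto simp: inj_on_def)
  next
    case False
    then have "{r - c, r - (c + 1)} \<subseteq> {1..r}" "r - c \<noteq> r - (c + 1)" using assms by auto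
    then have "card ({1..r} - {r - c, r - (c + 1)}) = r - 2"
      by (subst card_Diff_subset) auto
    then show ?thesis using False by (subst card_image) (auto simp: inj_on_def)
  qed
  have disj: "w \<notin> clique r c" if "w \<in> clique r (Suc c)" for w
    using that assms by (auto simp: clique_def diag_inject)
  have "card (ball (H_graph r) 2 (diag r c r)) = (r + 2) + 1 + r + r +
      (if c = 0 then r - 1 else r - 2) + (if c = r - 1 then r - 1 else r - 2)"
    unfolding ball_2_last_column[OF assms]
    by (intro card_Un_eq card_clique; use assms row col in \<open>auto simp: Pr_in_clique_iff disj\<close>)
  then show ?thesis using assms by auto
qed

section \<open>Balls of radius two around the remaining vertices\<close>

lemma clique_subset_closed_nbrs:
  assumes "r > 2" "c \<le> r" "v \<in> clique r c"
  shows "clique r c \<subseteq> closed_nbrs r v"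
  using assms by (auto simp: clique_def closed_nbrs_diag)

lemma ball_2_I:
  assumes "r > 2" "v \<in> H_verts r" "y \<in> closed_nbrs r v" "w \<in> closed_nbrs r y"
  shows "w \<in> ball (H_graph r) 2 v"
  using assms by (auto simp: ball_2_H)

lemma ball_2_Sg_0:
  assumes "r > 2"
  shows "ball (H_graph r) 2 (Sg 0) = H_verts r"
proof
  have v: "Sg 0 \<in> H_verts r" by (simp add: Sg_verts)
  show "ball (H_graph r) 2 (Sg 0) \<subseteq> H_verts r"
    using ball_subset_verts[OF H_mixed_graph[OF assms], of "Sg 0"] v by simp
  show "H_verts r \<subseteq> ball (H_graph r) 2 (Sg 0)"
  proof
    fix w assume w: "w \<in> H_verts r"
    show "w \<in> ball (H_graph r) 2 (Sg 0)"
    proof (cases w)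
      case (Sg k)
      then show ?thesis
        using w assms by (intro ball_2_I[OF assms v, of "Sg 0"]) (auto simp: closed_nbrs_Sg_0 Sg_verts)
    next
      case (Pr i j)
      then consider "i \<in> {1..r}" "j \<in> {1..r}" | "i = r + 1" "j \<in> {1..r + 1}"
        using w by (force simp: H_verts_def)
      then have "Pr i j \<in> closed_nbrs r (Sg i)"
        by cases (auto simp: closed_nbrs_Sg closed_nbrs_Sg_last simp del: One_nat_def)
      moreover have "i \<le> r + 1" using w Pr by (auto simp: H_verts_def)
      ultimately show ?thesis
        using Pr assms by (intro ball_2_I[OF assms v, of "Sg i"]) (auto simp: closed_nbrs_Sg_0)
    qed
  qed
qed

text \<open>
  Row \<open>i\<close> meets every clique except clique \<open>r + 1 - i\<close>.  That clique is reached by the arcs from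
  row \<open>i\<close>: rule (6) gives its members in columns below \<open>r\<close> other than \<open>r + 1 - i\<close>, and rule (5)
  the one in column \<open>r + 1 - i\<close>.  For \<open>i = 1\<close> these are all, and \<open>Pr 0 r\<close> is not a vertex, so
  that nothing is removed.
\<close>

lemma ball_2_Sg:
  assumes "r > 2" "i \<in> {1..r}"
  shows "ball (H_graph r) 2 (Sg i) = H_verts r - {Pr (i - 1) r}"
proof
  have v: "Sg i \<in> H_verts r" using assms by (simp add: Sg_verts)
  have "Pr (i - 1) r \<notin> ball (H_graph r) 2 (Sg i)"
  proof
    assume "Pr (i - 1) r \<in> ball (H_graph r) 2 (Sg i)"
    then consider "Pr (i - 1) r \<in> closed_nbrs r (Sg 0)" | "Pr (i - 1) r \<in> closed_nbrs r (Sg i)"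
      | j where "j \<in> {1..r}" "Pr (i - 1) r \<in> closed_nbrs r (Pr i j)"
      using assms by (auto simp: ball_2_H[OF assms(1) v] closed_nbrs_Sg)
    then show False
    proof cases
      case 1
      then show ?thesis using assms by (auto simp: closed_nbrs_Sg_0)
    next
      case 2
      then show ?thesis using assms by (auto simp: closed_nbrs_Sg)
    next
      case 3
      then show ?thesis using assms by (auto simp: closed_nbrs_def clique_of_def split: if_splits)
    qed
  qed
  then show "ball (H_graph r) 2 (Sg i) \<subseteq> H_verts r - {Pr (i - 1) r}"
    using ball_subset_verts[OF H_mixed_graph[OF assms(1)], of "Sg i" 2] v by auto
  show "H_verts r - {Pr (i - 1) r} \<subseteq> ball (H_graph r) 2 (Sg i)"
  proof
    fix w assume w: "w \<in> H_verts r - {Pr (i - 1) r}"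
    have "\<exists>y \<in> closed_nbrs r (Sg i). w \<in> closed_nbrs r y"
      using w[THEN DiffD1]
    proof (cases rule: H_verts_cases)
      case (1 k)
      then show ?thesis using assms
        by (intro bexI[of _ "Sg 0"]) (auto simp: closed_nbrs_Sg_0 closed_nbrs_Sg)
    next
      case 2
      then show ?thesis using assms
        by (intro bexI[of _ "Pr i r"]) (auto simp: closed_nbrs_Sg closed_nbrs_def)
    next
      case (3 d x)
      consider (other) "d + i \<noteq> r + 1" | (last) "d + i = r + 1" "x = d"
        | (same) "d + i = r + 1" "x \<noteq> d" by blast
      then show ?thesis
      proof cases
        case other
        \<comment> \<open>The column in which row \<open>i\<close> meets clique \<open>d\<close>; it is not \<open>r + 1\<close> in this case.\<close>
        define j where "j = (if i + d \<le> r then i + d else i + d - (r + 1))"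
        have "j \<in> {1..r}" "Pr i j \<in> clique r d"
          using other assms 3 by (auto simp: j_def Pr_in_clique_iff)
        moreover have "w \<in> clique r d" using 3 by (simp add: clique_def)
        ultimately show ?thesis
          using clique_subset_closed_nbrs[OF assms(1) 3(2)] assms
          by (intro bexI[of _ "Pr i j"]) (auto simp: closed_nbrs_Sg)
      next
        case last
        then have "w = arc_head r (Pr i r)" using 3 assms by (auto simp: diag_def)
        then show ?thesis using assms
          by (intro bexI[of _ "Pr i r"]) (auto simp: closed_nbrs_Sg closed_nbrs_def)
      next
        case same
        have "w = Pr (i - 1) r" if "x = r"
          using that same 3 assms by (auto simp: diag_def)
        then have x: "x < r" using w 3 by force
        then have "w = arc_head r (Pr i (r - x))" using same 3 assms by (auto simp: diag_def)
        then show ?thesis using assms x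
          by (intro bexI[of _ "Pr i (r - x)"]) (auto simp: closed_nbrs_Sg closed_nbrs_def)
      qed
    qed
    then show "w \<in> ball (H_graph r) 2 (Sg i)" using ball_2_I[OF assms(1) v] by blast
  qed
qed

lemma closed_nbrs_last_row:
  assumes "r > 2" "j \<in> {1..r}"
  shows "closed_nbrs r (Pr (r + 1) j) = {Sg (r + 1), Sg (r + 1 - j)} \<union> clique r j"
proof -
  have "Pr (r + 1) j = diag r j j" by (simp add: diag_def)
  then show ?thesis
    using closed_nbrs_diag[of r j j] assms by (simp add: tree_nbr_def diag_arc_def)
qed

lemma closed_nbrs_last_column:
  assumes "r > 2" "i \<in> {1..r}"
  shows "closed_nbrs r (Pr i r) = {Pr (r + 1) (r + 1), Pr (r + 1) (r + 1 - i)} \<union> clique r (r - i)"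
proof -
  have "Pr i r = diag r (r - i) r" "tree_nbr r (r - i) r = Pr (r + 1) (r + 1)"
    "diag_arc r (r - i) r = Pr (r + 1) (r + 1 - i)"
    using assms by (auto simp: diag_def tree_nbr_def diag_arc_def)
  then show ?thesis
    using closed_nbrs_diag[of r "r - i" r] assms by simp
qed

text \<open>
  Row \<open>r + 1\<close> meets every clique except clique \<open>0\<close>, the main diagonal, and the arcs from row
  \<open>r + 1\<close> do not lead there.  Only \<open>(r, r)\<close> is reached, through \<open>(r + 1, r + 1)\<close>.
\<close>

lemma ball_2_Sg_last:
  assumes "r > 2"
  shows "ball (H_graph r) 2 (Sg (r + 1)) = H_verts r - (\<lambda>j. Pr j j) ` {1..r - 1}"
proof
  let ?w = "Pr (r + 1) (r + 1)"
  have v: "Sg (r + 1) \<in> H_verts r" by (simp add: Sg_verts)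
  have nb: "closed_nbrs r (Sg (r + 1)) = {Sg (r + 1), ?w} \<union> Pr (r + 1) ` {1..r}"
  proof -
    have "{1..r + 1} = insert (r + 1) {1..r}" by auto
    then show ?thesis unfolding closed_nbrs_Sg_last by blast
  qed
  have "Pr j j \<notin> ball (H_graph r) 2 (Sg (r + 1))" if j: "j \<in> {1..r - 1}" for j
  proof
    assume "Pr j j \<in> ball (H_graph r) 2 (Sg (r + 1))"
    then have "Pr j j \<in> (\<Union>y \<in> {Sg (r + 1), ?w} \<union> Pr (r + 1) ` {1..r}. closed_nbrs r y)"
      unfolding ball_2_H[OF assms v] nb .
    then consider "Pr j j \<in> closed_nbrs r (Sg (r + 1))" | "Pr j j \<in> closed_nbrs r ?w"
      | l where "l \<in> {1..r}" "Pr j j \<in> closed_nbrs r (Pr (r + 1) l)"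
      by blast
    then show False
    proof cases
      case 1
      then show ?thesis using j assms unfolding nb by auto
    next
      case 2
      then show ?thesis using j assms unfolding closed_nbrs_last by auto
    next
      case 3
      then show ?thesis
        using j unfolding closed_nbrs_last_row[OF assms 3(1)] by (auto simp: Pr_in_clique_iff)
    qed
  qed
  then show "ball (H_graph r) 2 (Sg (r + 1)) \<subseteq> H_verts r - (\<lambda>j. Pr j j) ` {1..r - 1}"
    using ball_subset_verts[OF H_mixed_graph[OF assms(1)], of "Sg (r + 1)" 2] v by auto
  show "H_verts r - (\<lambda>j. Pr j j) ` {1..r - 1} \<subseteq> ball (H_graph r) 2 (Sg (r + 1))"
  proof
    fix w assume w: "w \<in> H_verts r - (\<lambda>j. Pr j j) ` {1..r - 1}"
    have "\<exists>y \<in> {Sg (r + 1), ?w} \<union> Pr (r + 1) ` {1..r}. w \<in> closed_nbrs r y"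
      using w[THEN DiffD1]
    proof (cases rule: H_verts_cases)
      case (1 k)
      then consider "k = 0" | "k = r + 1" | "k \<in> {1..r}" by fastforce
      then show ?thesis
      proof cases
        case 1
        then have "w \<in> closed_nbrs r ?w" using \<open>w = Sg k\<close> by (simp only: closed_nbrs_last) simp
        then show ?thesis by (intro bexI[of _ ?w]) auto
      next
        case 2
        then show ?thesis using \<open>w = Sg k\<close> by (intro bexI[of _ "Sg (r + 1)"]) (auto simp: closed_nbrs_def)
      next
        case 3
        then have "w \<in> closed_nbrs r (Pr (r + 1) (r + 1 - k))"
          using \<open>w = Sg k\<close> assms by (subst closed_nbrs_last_row) auto
        then show ?thesis using 3 by (intro bexI[of _ "Pr (r + 1) (r + 1 - k)"]) auto
      qed
    next
      case 2
      then show ?thesis by (intro bexI[of _ ?w]) (auto simp: closed_nbrs_def)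
    next
      case (3 d x)
      then have wd: "w \<in> clique r d" by (simp add: clique_def)
      show ?thesis
      proof (cases "d = 0")
        case True
        then have "w = Pr x x" using 3 by (auto simp: diag_def)
        then have "w = Pr r r" using w 3 by fastforce
        then have "w \<in> closed_nbrs r ?w" using assms by (simp only: closed_nbrs_last) simp
        then show ?thesis by (intro bexI[of _ ?w]) auto
      next
        case False
        then have "w \<in> closed_nbrs r (Pr (r + 1) d)"
          using wd 3 assms by (subst closed_nbrs_last_row) auto
        then show ?thesis using False 3 by (intro bexI[of _ "Pr (r + 1) d"]) auto
      qed
    qed
    then show "w \<in> ball (H_graph r) 2 (Sg (r + 1))"
      using ball_2_I[OF assms v] unfolding nb by blast
  qed
qed

text \<open>
  The vertices \<open>(i, r)\<close> with \<open>i \<le> r\<close> meet every clique except clique \<open>r\<close>, of which only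
  \<open>(r + 1, r)\<close> is reached, by the arc from \<open>(1, r)\<close>.
\<close>

lemma ball_2_last:
  assumes "r > 2"
  shows "ball (H_graph r) 2 (Pr (r + 1) (r + 1)) = H_verts r - (\<lambda>j. Pr (j + 1) j) ` {1..r - 1}"
proof
  let ?w = "Pr (r + 1) (r + 1)"
  note v = last_verts[of r]
  have "Pr (j + 1) j \<notin> ball (H_graph r) 2 ?w" if j: "j \<in> {1..r - 1}" for j
  proof
    assume "Pr (j + 1) j \<in> ball (H_graph r) 2 ?w"
    then have "Pr (j + 1) j \<in> (\<Union>y \<in> {Sg 0, ?w} \<union> (\<lambda>i. Pr i r) ` {1..r}. closed_nbrs r y)"
      unfolding ball_2_H[OF assms v] closed_nbrs_last .
    then consider "Pr (j + 1) j \<in> closed_nbrs r ?w" | "Pr (j + 1) j \<in> closed_nbrs r (Sg 0)"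
      | i where "i \<in> {1..r}" "Pr (j + 1) j \<in> closed_nbrs r (Pr i r)"
      by blast
    then show False
    proof cases
      case 1
      then show ?thesis using j assms unfolding closed_nbrs_last by auto
    next
      case 2
      then show ?thesis using assms by (auto simp: closed_nbrs_Sg_0)
    next
      case 3
      then show ?thesis
        using j unfolding closed_nbrs_last_column[OF assms 3(1)] by (auto simp: Pr_in_clique_iff)
    qed
  qed
  then show "ball (H_graph r) 2 ?w \<subseteq> H_verts r - (\<lambda>j. Pr (j + 1) j) ` {1..r - 1}"
    using ball_subset_verts[OF H_mixed_graph[OF assms(1)], of ?w 2] v by auto
  show "H_verts r - (\<lambda>j. Pr (j + 1) j) ` {1..r - 1} \<subseteq> ball (H_graph r) 2 ?w"
  proof
    fix w assume w: "w \<in> H_verts r - (\<lambda>j. Pr (j + 1) j) ` {1..r - 1}"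
    have "\<exists>y \<in> {Sg 0, ?w} \<union> (\<lambda>i. Pr i r) ` {1..r}. w \<in> closed_nbrs r y"
      using w[THEN DiffD1]
    proof (cases rule: H_verts_cases)
      case (1 k)
      then show ?thesis
        using assms by (intro bexI[of _ "Sg 0"]) (auto simp: closed_nbrs_Sg_0)
    next
      case 2
      then show ?thesis by (intro bexI[of _ ?w]) (auto simp: closed_nbrs_def)
    next
      case (3 d x)
      then have wd: "w \<in> clique r d" by (simp add: clique_def)
      show ?thesis
      proof (cases "d = r")
        case True
        then have "w = Pr (x + 1) x" using 3 by (auto simp: diag_def)
        then have "w = Pr (r + 1) r" using w 3 by fastforce
        then have "w \<in> closed_nbrs r (Pr 1 r)" using assms by (subst closed_nbrs_last_column) auto
        then show ?thesis using assms by (intro bexI[of _ "Pr 1 r"]) auto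
      next
        case False
        then have "w \<in> closed_nbrs r (Pr (r - d) r)"
          using wd 3 assms by (subst closed_nbrs_last_column) auto
        then show ?thesis using False 3 by (intro bexI[of _ "Pr (r - d) r"]) auto
      qed
    qed
    then show "w \<in> ball (H_graph r) 2 ?w"
      using ball_2_I[OF assms v] unfolding closed_nbrs_last by blast
  qed
qed

section \<open>Balls of radius three\<close>

lemma ball_adj_subset:
  assumes "mixed_adj G v w"
  shows "ball G k w \<subseteq> ball G (Suc k) v"
  using assms by (induction k) auto

lemma ball_3_from_nbr:
  assumes "r > 2" "v \<in> H_verts r" "y \<in> closed_nbrs r v"
  shows "ball (H_graph r) 2 y \<subseteq> ball (H_graph r) 3 v"
proof (cases "y = v")
  case True
  then show ?thesis by (simp add: ball_mono)
next
  case False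
  then have "mixed_adj (H_graph r) v y"
    using assms by (auto simp: H_adj_iff closed_nbrs_def)
  from ball_adj_subset[OF this, of 2] show ?thesis by (simp only: numeral_3_eq_3 numeral_2_eq_2)
qed

lemma ball_3_I:
  assumes "r > 2" "v \<in> H_verts r" "y \<in> ball (H_graph r) 2 v" "w \<in> closed_nbrs r y"
  shows "w \<in> ball (H_graph r) 3 v"
proof -
  have "ball (H_graph r) 3 v = (\<Union>u \<in> ball (H_graph r) 2 v. closed_nbrs r u)"
    using ball_Suc_H[OF assms(1,2), of 2] by (simp only: numeral_3_eq_3 numeral_2_eq_2)
  then show ?thesis using assms(3,4) by blast
qed

lemma ball_3_clique:
  assumes "r > 2" "v \<in> H_verts r" "c \<le> r" "y \<in> clique r c" "y \<in> ball (H_graph r) 2 v"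
  shows "clique r c \<subseteq> ball (H_graph r) 3 v"
  using ball_3_I[OF assms(1,2,5)] clique_subset_closed_nbrs[OF assms(1,3,4)] by blast

text \<open>
  A vertex of row \<open>i \<le> r\<close> and column below \<open>r\<close> is adjacent to \<open>Sg i\<close>, from where two steps lead to
  every vertex but \<open>(i - 1, r)\<close>, and that one is reached through its clique or, from clique \<open>r\<close>, by the arc of \<open>Sg (i - 1)\<close>.  Vertices of the last row
  can use their arc to some \<open>Sg k\<close> in the same way, and those of the last column use the edge to
  \<open>(r + 1, r + 1)\<close>.  In the last case it remains to enter clique \<open>r\<close> within two steps.
\<close>

lemma ball_3_H:
  assumes "r > 2" "v \<in> H_verts r"
  shows "ball (H_graph r) 3 v = H_verts r"
proof
  show "ball (H_graph r) 3 v \<subseteq> H_verts r"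
    using ball_subset_verts[OF H_mixed_graph[OF assms(1)], of v 3] assms(2) by simp
  have mono: "ball (H_graph r) 2 v \<subseteq> ball (H_graph r) 3 v" by (rule ball_mono) simp
  have from_Sg: "H_verts r \<subseteq> ball (H_graph r) 3 v"
    if "Sg i \<in> closed_nbrs r v" "i \<in> {1..r}" "i \<noteq> 1 \<Longrightarrow> Pr (i - 1) r \<in> ball (H_graph r) 3 v" for i
  proof -
    have "H_verts r - {Pr (i - 1) r} \<subseteq> ball (H_graph r) 3 v"
      using ball_3_from_nbr[OF assms that(1)] ball_2_Sg[OF assms(1) that(2)] by simp
    moreover have "Pr 0 r \<notin> H_verts r" by (simp add: H_verts_def)
    ultimately show ?thesis using that(3) by (cases "i = 1") auto
  qed
  show "H_verts r \<subseteq> ball (H_graph r) 3 v"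
    using assms(2)
  proof (cases rule: H_verts_cases)
    case (1 i)
    then consider "i = 0" | "i \<in> {1..r}" | "i = r + 1" by fastforce
    then show ?thesis
    proof cases
      case 1
      then show ?thesis using mono \<open>v = Sg i\<close> ball_2_Sg_0[OF assms(1)] by simp
    next
      case i: 2
      have "Pr (i - 1) r \<in> ball (H_graph r) 3 v" if "i \<noteq> 1"
      proof (rule subsetD[OF ball_3_clique[OF assms, of "r + 1 - i" "Pr (r + 1) (r + 1 - i)"]])
        show "Pr (r + 1) (r + 1 - i) \<in> ball (H_graph r) 2 v"
          using i that \<open>v = Sg i\<close> assms(1) by (auto simp: ball_2_Sg H_verts_def)
      qed (use i that in \<open>auto simp: Pr_in_clique_iff\<close>)
      moreover have "Sg i \<in> closed_nbrs r v" using \<open>v = Sg i\<close> by (simp add: closed_nbrs_def)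
      ultimately show ?thesis using from_Sg i by blast
    next
      case 3
      have "Pr r r \<in> ball (H_graph r) 2 v"
        unfolding \<open>v = Sg i\<close> 3 ball_2_Sg_last[OF assms(1)] using assms(1) by (auto simp: H_verts_def)
      then have "clique r 0 \<subseteq> ball (H_graph r) 3 v"
        using assms(1) by (intro ball_3_clique[OF assms]) (auto simp: Pr_in_clique_iff)
      moreover have "(\<lambda>j. Pr j j) ` {1..r - 1} \<subseteq> clique r 0" by (auto simp: Pr_in_clique_iff)
      moreover have "H_verts r - (\<lambda>j. Pr j j) ` {1..r - 1} \<subseteq> ball (H_graph r) 3 v"
        using mono unfolding \<open>v = Sg i\<close> 3 ball_2_Sg_last[OF assms(1)] .
      ultimately show ?thesis by blast
    qed
  next
    case 2
    have "Pr (r + 1) r \<in> ball (H_graph r) 2 v"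
      unfolding 2 ball_2_last[OF assms(1)] using assms(1) by (auto simp: H_verts_def)
    then have "clique r r \<subseteq> ball (H_graph r) 3 v"
      using assms(1) by (intro ball_3_clique[OF assms]) (auto simp: Pr_in_clique_iff)
    moreover have "(\<lambda>j. Pr (j + 1) j) ` {1..r - 1} \<subseteq> clique r r" by (auto simp: Pr_in_clique_iff)
    moreover have "H_verts r - (\<lambda>j. Pr (j + 1) j) ` {1..r - 1} \<subseteq> ball (H_graph r) 3 v"
      using mono unfolding 2 ball_2_last[OF assms(1)] .
    ultimately show ?thesis by blast
  next
    case (3 c x)
    have nb: "closed_nbrs r v = {tree_nbr r c x, diag_arc r c x} \<union> clique r c"
      unfolding 3(1) using 3 assms(1) by (intro closed_nbrs_diag)
    consider (row) "x = c" | (column) "x = r" "c < r" | (cl) "c = r" "x < r"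
      | (generic) "c < r" "x < r" "x \<noteq> c" using 3 by fastforce
    then show ?thesis
    proof cases
      case row
      have "Pr (r - c) r \<in> clique r c" if "c \<noteq> r" using that 3 row assms(1) by (auto simp: Pr_in_clique_iff)
      moreover have "clique r c \<subseteq> ball (H_graph r) 3 v"
        using 3 by (intro ball_3_clique[OF assms, of c v] subsetD[OF ball_mono[of 0 2]]) (auto simp: clique_def)
      ultimately show ?thesis
        using row 3 nb by (intro from_Sg[of "r + 1 - c"]) (auto simp: diag_arc_def)
    next
      case column
      have "H_verts r - (\<lambda>j. Pr (j + 1) j) ` {1..r - 1} \<subseteq> ball (H_graph r) 3 v"
        unfolding ball_2_last[OF assms(1), symmetric]
        using column nb by (intro ball_3_from_nbr[OF assms]) (auto simp: tree_nbr_def)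
      moreover have "clique r r \<subseteq> ball (H_graph r) 3 v"
      proof (cases "c = r - 1")
        case True
        then have "clique r r \<subseteq> ball (H_graph r) 2 v"
          using 3 column ball_2_last_column[OF assms(1), of c] by auto
        then show ?thesis using mono by blast
      next
        case False
        then have "Pr (r - c) (r - c - 1) \<in> ball (H_graph r) 2 v"
          using 3 column ball_2_last_column[OF assms(1), of c] by auto
        moreover have "Pr (r - c) (r - c - 1) \<in> clique r r"
          using False column by (auto simp: Pr_in_clique_iff)
        ultimately show ?thesis by (intro ball_3_clique[OF assms]) auto
      qed
      moreover have "(\<lambda>j. Pr (j + 1) j) ` {1..r - 1} \<subseteq> clique r r" by (auto simp: Pr_in_clique_iff)
      ultimately show ?thesis by blast
    next
      case cl
      have "Sg x \<in> ball (H_graph r) 2 v"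
        using cl 3 ball_2_last_clique[OF assms(1), of x] by auto
      then have "Pr x r \<in> ball (H_graph r) 3 v"
        using cl 3 assms(1) by (intro ball_3_I[OF assms]) (auto simp: closed_nbrs_Sg)
      then show ?thesis
        using cl 3 nb by (intro from_Sg[of "x + 1"]) (auto simp: tree_nbr_def)
    next
      case generic
      define i where "i = (if c < x then x - c else x + (r + 1) - c)"
      have i: "i \<in> {1..r}" "x = i + c \<or> x + (r + 1) = i + c" "x \<in> {1..<r}"
        using generic 3 by (auto simp: i_def)
      have "clique r (r + 1 - i) \<subseteq> ball (H_graph r) 2 v"
        unfolding 3(1) ball_2_generic[OF assms(1) generic(1) i(3) i(1,2)] by blast
      moreover have "Pr (i - 1) r \<in> clique r (r + 1 - i)" if "i \<noteq> 1"
        using i(1) that by (auto simp: Pr_in_clique_iff)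
      ultimately have "Pr (i - 1) r \<in> ball (H_graph r) 3 v" if "i \<noteq> 1" using that mono by blast
      moreover have "tree_nbr r c x = Sg i" using generic 3 by (auto simp: tree_nbr_def i_def)
      ultimately show ?thesis using nb i(1) by (intro from_Sg[of i]) auto
    qed
  qed
qed

section \<open>Statuses\<close>

text \<open>
  The radii \<open>0\<close>, \<open>1\<close> and \<open>2\<close> contribute the order minus \<open>1\<close>, minus \<open>r + 2\<close> and minus the size
  of the ball of radius two.
\<close>

lemma status_H:
  assumes "r > 2" "v \<in> H_verts r"
  shows "status (H_graph r) v = enat (3 * r\<^sup>2 + 5 * r + 6 - card (ball (H_graph r) 2 v))"
proof -
  let ?G = "H_graph r"
  note G = H_mixed_graph[OF assms(1)]
  have miss: "card (H_verts r - ball ?G k v) = r\<^sup>2 + 2 * r + 3 - card (ball ?G k v)" for k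
  proof -
    have "ball ?G k v \<subseteq> H_verts r" using ball_subset_verts[OF G, of v k] assms(2) by simp
    then show ?thesis
      using finite_H_verts[of r] by (simp add: card_Diff_subset finite_subset card_H_verts)
  qed
  have le: "card (ball ?G 2 v) \<le> r\<^sup>2 + 2 * r + 3"
    using ball_subset_verts[OF G, of v 2] assms(2)
    by (subst card_H_verts[symmetric], intro card_mono finite_H_verts) simp
  have "status ?G v = enat (\<Sum>k<3. card (H_verts r - ball ?G k v))"
    using status_eq_sum_card[OF G, of v 3] assms(2) ball_3_H[OF assms] by simp
  also have "(\<Sum>k<3. card (H_verts r - ball ?G k v)) =
      (r\<^sup>2 + 2 * r + 3 - card (ball ?G 0 v)) + (r\<^sup>2 + 2 * r + 3 - card (ball ?G 1 v)) +
      (r\<^sup>2 + 2 * r + 3 - card (ball ?G 2 v))"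
    by (simp only: miss numeral_3_eq_3 numeral_2_eq_2 One_nat_def sum.lessThan_Suc) simp
  also have "card (ball ?G 1 v) = r + 2"
    using ball_1_H[OF assms] card_closed_nbrs[OF assms] by (simp only: One_nat_def)
  also have "card (ball ?G 0 v) = 1" by simp
  also have "(r\<^sup>2 + 2 * r + 3 - 1) + (r\<^sup>2 + 2 * r + 3 - (r + 2)) + (r\<^sup>2 + 2 * r + 3 - card (ball ?G 2 v)) =
      3 * r\<^sup>2 + 5 * r + 6 - card (ball ?G 2 v)"
    using le by simp
  finally show ?thesis .
qed

lemma card_ball_2_complement:
  assumes "r > 2" "v \<in> H_verts r" "ball (H_graph r) 2 v = H_verts r - X" "X \<subseteq> H_verts r"
  shows "card (ball (H_graph r) 2 v) = r\<^sup>2 + 2 * r + 3 - card X"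
  using assms finite_H_verts[of r] by (simp add: card_Diff_subset finite_subset card_H_verts)

lemma status_Sg_0_1:
  assumes "r > 2" "v \<in> {Sg 0, Sg 1}"
  shows "status (H_graph r) v = enat (2 * r\<^sup>2 + 3 * r + 3)"
proof -
  have v: "v \<in> H_verts r" using assms by (auto simp: Sg_verts)
  have "Pr 0 r \<notin> H_verts r" by (simp add: H_verts_def)
  then have "ball (H_graph r) 2 v = H_verts r"
    using assms ball_2_Sg_0[of r] ball_2_Sg[of r 1] by auto
  then show ?thesis using status_H[OF assms(1) v] by (simp add: card_H_verts)
qed

lemma status_Sg:
  assumes "r > 2" "v \<in> Sg ` {2..r}"
  shows "status (H_graph r) v = enat (2 * r\<^sup>2 + 3 * r + 4)"
proof -
  obtain i where i: "v = Sg i" "i \<in> {2..r}" using assms(2) by auto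
  have v: "v \<in> H_verts r" using i by (auto simp: Sg_verts)
  have "Pr (i - 1) r \<in> H_verts r" using assms(1) i(2) by (intro Pr_verts) auto
  moreover have "ball (H_graph r) 2 v = H_verts r - {Pr (i - 1) r}"
    unfolding i(1) using i(2) by (intro ball_2_Sg assms(1)) simp
  ultimately have "card (ball (H_graph r) 2 v) = r\<^sup>2 + 2 * r + 3 - 1"
    using card_ball_2_complement[OF assms(1) v, of "{Pr (i - 1) r}"] by simp
  then show ?thesis using status_H[OF assms(1) v] by simp
qed

lemma status_Sg_last:
  assumes "r > 2" "v \<in> {Sg (r + 1), Pr (r + 1) (r + 1)}"
  shows "status (H_graph r) v = enat (2 * r\<^sup>2 + 4 * r + 2)"
proof -
  have v: "v \<in> H_verts r" using assms last_verts by (auto simp: Sg_verts)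
  have "card (ball (H_graph r) 2 v) = r\<^sup>2 + 2 * r + 3 - (r - 1)"
  proof (cases "v = Sg (r + 1)")
    case True
    have "(\<lambda>j. Pr j j) ` {1..r - 1} \<subseteq> H_verts r" by (auto intro!: Pr_verts)
    moreover have "card ((\<lambda>j. Pr j j) ` {1..r - 1}) = r - 1"
      by (subst card_image) (auto simp: inj_on_def)
    ultimately show ?thesis
      using card_ball_2_complement[OF assms(1) v] ball_2_Sg_last[OF assms(1)] True by simp
  next
    case False
    have "(\<lambda>j. Pr (j + 1) j) ` {1..r - 1} \<subseteq> H_verts r" by (auto intro!: Pr_verts)
    moreover have "card ((\<lambda>j. Pr (j + 1) j) ` {1..r - 1}) = r - 1"
      by (subst card_image) (auto simp: inj_on_def)
    moreover have "v = Pr (r + 1) (r + 1)" using False assms(2) by simp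
    ultimately show ?thesis
      using card_ball_2_complement[OF assms(1) v] ball_2_last[OF assms(1)] by simp
  qed
  then show ?thesis using status_H[OF assms(1) v] assms(1) by simp
qed

text \<open>
  The vertices \<open>(c, x)\<close>, in clique coordinates, equal to \<open>(r, r)\<close>, \<open>(0, r)\<close>, \<open>(r - 1, r)\<close>,
  \<open>(0, 1)\<close> and \<open>(r - 2, r - 1)\<close>.  For \<open>r > 2\<close> they are those whose ball of radius two has
  \<open>5r\<close> elements.
\<close>

definition exceptional :: "nat \<Rightarrow> H_vertex set" where
  "exceptional r = {Pr (r + 1) r, Pr r r, Pr 1 r, Pr 1 1, Pr 1 (r - 1)}"

lemma status_exceptional:
  assumes "r > 2" "v \<in> exceptional r"
  shows "status (H_graph r) v = enat (3 * r\<^sup>2 + 6)"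
proof -
  consider "v = diag r r r" | "v = diag r 0 r" | "v = diag r (r - 1) r" | "v = diag r 0 1"
    | "v = diag r (r - 2) (r - 1)"
    using assms by (auto simp: exceptional_def diag_def)
  then have "v \<in> H_verts r \<and> card (ball (H_graph r) 2 v) = 5 * r"
    using assms(1) card_ball_2_corner[of r] card_ball_2_last_column[of r 0]
      card_ball_2_last_column[of r "r - 1"] card_ball_2_generic[of r 0 1]
      card_ball_2_generic[of r "r - 2" "r - 1"]
    by cases (auto intro!: diag_verts)
  then show ?thesis using status_H[of r v] assms(1) by simp
qed

lemma status_last_row_column:
  assumes "r > 2" "v \<in> Pr (r + 1) ` {1..<r} \<union> (\<lambda>i. Pr i r) ` {2..<r}"
  shows "status (H_graph r) v = enat (3 * r\<^sup>2 + 7)"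
proof -
  have "v \<in> H_verts r \<and> card (ball (H_graph r) 2 v) = 5 * r - 1"
    using assms(2)
  proof
    assume "v \<in> Pr (r + 1) ` {1..<r}"
    then obtain c where "v = diag r c c" "c \<in> {1..<r}" by (auto simp: diag_def)
    then show ?thesis using card_ball_2_last_row[of r c] assms(1) by (auto intro!: diag_verts)
  next
    assume "v \<in> (\<lambda>i. Pr i r) ` {2..<r}"
    then obtain i where i: "v = Pr i r" "i \<in> {2..<r}" by auto
    then have "v = diag r (r - i) r" by (auto simp: diag_def)
    then show ?thesis
      using card_ball_2_last_column[of r "r - i"] assms(1) i(2) by (auto intro!: diag_verts)
  qed
  then show ?thesis using status_H[of r v] assms(1) by simp
qed

lemma status_last_clique:
  assumes "r > 2" "x \<in> {1..<r}"
  shows "status (H_graph r) (Pr (x + 1) x) =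
    enat (if x = 1 \<or> x = r - 1 then 3 * r\<^sup>2 + r + 6 else 3 * r\<^sup>2 + r + 5)"
proof -
  have "Pr (x + 1) x = diag r r x" using assms by (auto simp: diag_def)
  moreover have "diag r r x \<in> H_verts r" using assms by (intro diag_verts) auto
  ultimately show ?thesis
    using status_H[of r "diag r r x"] card_ball_2_last_clique[OF assms] assms(1) by auto
qed

lemma status_generic:
  assumes "r > 2" "c < r" "x \<in> {1..<r}" "x \<noteq> c" "diag r c x \<notin> exceptional r"
  shows "status (H_graph r) (diag r c x) = enat (3 * r\<^sup>2 + 5)"
proof -
  have "\<not> (x = c + 1 \<and> (c = 0 \<or> c = r - 2))"
    using assms by (auto simp: exceptional_def diag_def)
  moreover have "diag r c x \<in> H_verts r" using assms by (intro diag_verts) auto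
  ultimately show ?thesis
    using status_H[of r "diag r c x"] card_ball_2_generic[OF assms(1-4)] assms(1) by auto
qed

lemma image_mset_Un_const:
  assumes "image_mset f (mset_set A) = M" "finite A" "finite B" "A \<inter> B = {}"
    and "\<And>x. x \<in> B \<Longrightarrow> f x = a" "card B = n"
  shows "image_mset f (mset_set (A \<union> B)) = M + replicate_mset n a"
proof -
  have "image_mset f (mset_set B) = image_mset (\<lambda>_. a) (mset_set B)"
    using assms(3,5) by (intro image_mset_cong) simp
  then show ?thesis
    using assms(1-4,6) by (simp add: mset_set_Union image_mset_const_eq)
qed

text \<open>
  The sets \<open>A1\<close> to \<open>A8\<close> (without \<open>A4\<close>) collect the vertices whose ball of radius two has one of the special
  sizes.  The value \<open>3r\<^sup>2 + 5\<close> is taken on the complement of their union, so its multiplicity needs no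
  direct count but follows from the order of the graph.
\<close>

lemma H_status_vector:
  assumes "r > 2"
  shows "status_vector (H_graph r) =
      replicate_mset 2 (enat (2 * r^2 + 3 * r + 3)) +
      replicate_mset (r - 1) (enat (2 * r^2 + 3 * r + 4)) +
      replicate_mset 2 (enat (2 * r^2 + 4 * r + 2)) +
      replicate_mset (r^2 - 2 * r - 1) (enat (3 * r^2 + 5)) +
      replicate_mset 5 (enat (3 * r^2 + 6)) +
      replicate_mset (2 * r - 3) (enat (3 * r^2 + 7)) +
      replicate_mset (r - 3) (enat (3 * r^2 + r + 5)) +
      replicate_mset 2 (enat (3 * r^2 + r + 6))"
proof -
  let ?f = "status (H_graph r)"
  define A1 where "A1 = {Sg 0, Sg 1}"
  define A2 where "A2 = Sg ` {2..r}"
  define A3 where "A3 = {Sg (r + 1), Pr (r + 1) (r + 1)}"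
  define A5 where "A5 = exceptional r"
  define A6 where "A6 = Pr (r + 1) ` {1..<r} \<union> (\<lambda>i. Pr i r) ` {2..<r}"
  define A7 where "A7 = (\<lambda>x. Pr (x + 1) x) ` {2..<r - 1}"
  define A8 where "A8 = {Pr 2 1, Pr r (r - 1)}"
  note defs = A1_def A2_def A3_def A5_def A6_def A7_def A8_def exceptional_def
  define U where "U = A1 \<union> A2 \<union> A3 \<union> A5 \<union> A6 \<union> A7 \<union> A8"
  have fin: "finite A1" "finite A2" "finite A3" "finite A5" "finite A6" "finite A7" "finite A8"
    by (simp_all add: defs)
  have cards: "card A1 = 2" "card A2 = r - 1" "card A3 = 2" "card A5 = 5" "card A6 = 2 * r - 3"
    "card A7 = r - 3" "card A8 = 2"
  proof -
    show "card A1 = 2" "card A2 = r - 1" "card A3 = 2" by (simp_all add: defs)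
    show "card A5 = 5" "card A8 = 2" using assms by (auto simp: defs card_insert_if)
    have "card A6 = (r - 1) + (r - 2)"
      unfolding A6_def by (intro card_Un_eq) (auto simp: card_image inj_on_def)
    then show "card A6 = 2 * r - 3" by simp
    have "card A7 = card {2..<r - 1}" unfolding A7_def by (intro card_image) (simp add: inj_on_def)
    then show "card A7 = r - 3" by simp
  qed
  have disj: "A1 \<inter> A2 = {}" "(A1 \<union> A2) \<inter> A3 = {}" "(A1 \<union> A2 \<union> A3) \<inter> A5 = {}"
    "(A1 \<union> A2 \<union> A3 \<union> A5) \<inter> A6 = {}" "(A1 \<union> A2 \<union> A3 \<union> A5 \<union> A6) \<inter> A7 = {}"
    "(A1 \<union> A2 \<union> A3 \<union> A5 \<union> A6 \<union> A7) \<inter> A8 = {}"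
    using assms by (auto simp: defs)
  have sub: "U \<subseteq> H_verts r"
    using assms by (auto simp: U_def defs H_verts_def)
  have "card U = 2 + (r - 1) + 2 + 5 + (2 * r - 3) + (r - 3) + 2"
    unfolding U_def by (intro card_Un_eq cards disj finite_UnI fin)
  then have rest: "card (H_verts r - U) = r\<^sup>2 - 2 * r - 1"
    using sub fin assms by (simp add: card_Diff_subset U_def card_H_verts)
  have s4: "?f v = enat (3 * r\<^sup>2 + 5)" if v: "v \<in> H_verts r - U" for v
    using v[THEN DiffD1]
  proof (cases rule: H_verts_cases)
    case (1 i)
    then consider "i = 0" | "i = 1" | "i \<in> {2..r}" | "i = r + 1" by fastforce
    then have "v \<in> U" using 1 by cases (auto simp: U_def defs)
    then show ?thesis using v by blast
  next
    case 2
    then show ?thesis using v by (auto simp: U_def defs)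
  next
    case (3 c x)
    have "x \<noteq> c"
    proof
      assume "x = c"
      then have "v = Pr (r + 1) x" "x = r \<or> x \<in> {1..<r}" using 3 by (auto simp: diag_def)
      then show False using v by (auto simp: U_def defs)
    qed
    moreover have "\<not> (x = r \<and> c < r)"
    proof
      assume "x = r \<and> c < r"
      then have "v = Pr (r - c) r" "r - c = 1 \<or> r - c = r \<or> r - c \<in> {2..<r}"
        using 3 by (auto simp: diag_def)
      then show False using v by (auto simp: U_def defs)
    qed
    moreover have "\<not> (c = r \<and> x < r)"
    proof
      assume "c = r \<and> x < r"
      then have "v = Pr (x + 1) x" "x = 1 \<or> x = r - 1 \<or> x \<in> {2..<r - 1}"
        using 3 by (auto simp: diag_def)
      then show False using v assms by (auto simp: U_def defs)
    qed
    ultimately have "c < r" "x \<in> {1..<r}" "x \<noteq> c" using 3 by auto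
    moreover have "diag r c x \<notin> exceptional r" using v 3(1) by (auto simp: U_def A5_def)
    ultimately show ?thesis using status_generic[OF assms] 3(1) by simp
  qed
  have s7: "?f v = enat (3 * r\<^sup>2 + r + 5)" if "v \<in> A7" for v
    using that status_last_clique[OF assms] by (auto simp: A7_def)
  have s8: "?f v = enat (3 * r\<^sup>2 + r + 6)" if "v \<in> A8" for v
    using that status_last_clique[OF assms, of 1] status_last_clique[OF assms, of "r - 1"] assms
    by (auto simp: A8_def numeral_2_eq_2)
  have s2: "?f v = enat (2 * r\<^sup>2 + 3 * r + 4)" if "v \<in> A2" for v
    using that status_Sg[OF assms] by (simp add: A2_def)
  have s3: "?f v = enat (2 * r\<^sup>2 + 4 * r + 2)" if "v \<in> A3" for v
    using that status_Sg_last[OF assms] unfolding A3_def by blast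
  have s5: "?f v = enat (3 * r\<^sup>2 + 6)" if "v \<in> A5" for v
    using that status_exceptional[OF assms] by (simp add: A5_def)
  have s6: "?f v = enat (3 * r\<^sup>2 + 7)" if "v \<in> A6" for v
    using that status_last_row_column[OF assms] unfolding A6_def by blast
  have m1: "image_mset ?f (mset_set A1) = replicate_mset 2 (enat (2 * r\<^sup>2 + 3 * r + 3))"
  proof -
    have "replicate_mset 2 a = {#a, a#}" for a :: enat by (simp add: numeral_2_eq_2)
    moreover have "?f (Sg 0) = enat (2 * r\<^sup>2 + 3 * r + 3)" "?f (Sg 1) = enat (2 * r\<^sup>2 + 3 * r + 3)"
      by (intro status_Sg_0_1[OF assms]; simp)+
    ultimately show ?thesis by (simp add: A1_def del: One_nat_def)
  qed
  have "image_mset ?f (mset_set (U \<union> (H_verts r - U))) =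
      replicate_mset 2 (enat (2 * r^2 + 3 * r + 3)) +
      replicate_mset (r - 1) (enat (2 * r^2 + 3 * r + 4)) +
      replicate_mset 2 (enat (2 * r^2 + 4 * r + 2)) +
      replicate_mset 5 (enat (3 * r^2 + 6)) +
      replicate_mset (2 * r - 3) (enat (3 * r^2 + 7)) +
      replicate_mset (r - 3) (enat (3 * r^2 + r + 5)) +
      replicate_mset 2 (enat (3 * r^2 + r + 6)) +
      replicate_mset (r^2 - 2 * r - 1) (enat (3 * r^2 + 5))"
  proof (rule image_mset_Un_const[OF _ _ _ _ s4 rest])
    show "image_mset ?f (mset_set U) =
      replicate_mset 2 (enat (2 * r^2 + 3 * r + 3)) +
      replicate_mset (r - 1) (enat (2 * r^2 + 3 * r + 4)) +
      replicate_mset 2 (enat (2 * r^2 + 4 * r + 2)) +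
      replicate_mset 5 (enat (3 * r^2 + 6)) +
      replicate_mset (2 * r - 3) (enat (3 * r^2 + 7)) +
      replicate_mset (r - 3) (enat (3 * r^2 + r + 5)) +
      replicate_mset 2 (enat (3 * r^2 + r + 6))"
      unfolding U_def
      by (intro image_mset_Un_const m1 s2 s3 s5 s6 s7 s8 cards disj fin finite_UnI)
  qed (use finite_H_verts in \<open>simp_all add: U_def fin\<close>)
  moreover have "U \<union> (H_verts r - U) = H_verts r" using sub by blast
  ultimately show ?thesis by (simp add: status_vector_def ac_simps)
qed

text \<open>
  The radius is attained at the root \<open>Sg 0\<close>.  No vertex has eccentricity \<open>1\<close>, as a ball of radius one has
  only \<open>r + 2\<close> elements, and \<open>Sg 2\<close> misses one vertex within two steps.
\<close>

lemma H_radius_diameter: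
  assumes "r > 2"
  shows "mixed_radius (H_graph r) = enat 2" "mixed_diameter (H_graph r) = enat 3"
proof -
  let ?G = "H_graph r"
  note G = H_mixed_graph[OF assms]
  have fin: "finite (out_eccentricity ?G ` H_verts r)" using finite_H_verts by simp
  have ge: "enat 2 \<le> out_eccentricity ?G v" if v: "v \<in> H_verts r" for v
  proof -
    have "card (ball ?G 1 v) = r + 2"
      using ball_1_H[OF assms v] card_closed_nbrs[OF assms v] by (simp only: One_nat_def)
    then have "ball ?G 1 v \<noteq> H_verts r" using card_H_verts[of r] by auto
    then have "\<not> out_eccentricity ?G v \<le> enat 1"
      using out_eccentricity_le_iff[OF G, of v 1] v by simp
    then show ?thesis by (cases "out_eccentricity ?G v") auto
  qed
  have le: "out_eccentricity ?G v \<le> enat 3" if v: "v \<in> H_verts r" for v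
    using out_eccentricity_le_iff[OF G, of v 3] v ball_3_H[OF assms v] by simp
  have v: "Sg 0 \<in> H_verts r" "Sg 2 \<in> H_verts r" using assms by (simp_all add: Sg_verts)
  have "out_eccentricity ?G (Sg 0) \<le> enat 2"
    using out_eccentricity_le_iff[OF G, of "Sg 0" 2] v(1) ball_2_Sg_0[OF assms] by simp
  then have "out_eccentricity ?G (Sg 0) = enat 2" using ge[OF v(1)] by (rule antisym)
  then have "enat 2 \<in> out_eccentricity ?G ` H_verts r" using v(1) by (metis imageI)
  then show "mixed_radius ?G = enat 2"
    unfolding mixed_radius_def verts_H_graph
    using fin ge by (intro Min_eqI) auto
  have "Pr 1 r \<in> H_verts r" using assms by (intro Pr_verts) auto
  then have "ball ?G 2 (Sg 2) \<noteq> H_verts r" using ball_2_Sg[of r 2] assms by auto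
  then have "\<not> out_eccentricity ?G (Sg 2) \<le> enat 2"
    using out_eccentricity_le_iff[OF G, of "Sg 2" 2] v(2) by simp
  then have "out_eccentricity ?G (Sg 2) = enat 3"
    using le[OF v(2)] by (cases "out_eccentricity ?G (Sg 2)") auto
  then have "enat 3 \<in> out_eccentricity ?G ` H_verts r" using v(2) by (metis imageI)
  then show "mixed_diameter ?G = enat 3"
    unfolding mixed_diameter_def verts_H_graph
    using fin le by (intro Max_eqI) auto
qed

theorem proposition4p2:
  fixes r :: nat
  assumes "r > 2"
  shows "mixed_radial_moore_graph r 1 2 (H_graph r) \<and>
    status_vector (H_graph r) =
      replicate_mset 2 (enat (2 * r^2 + 3 * r + 3)) +
      replicate_mset (r - 1) (enat (2 * r^2 + 3 * r + 4)) +
      replicate_mset 2 (enat (2 * r^2 + 4 * r + 2)) +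
      replicate_mset (r^2 - 2 * r - 1) (enat (3 * r^2 + 5)) +
      replicate_mset 5 (enat (3 * r^2 + 6)) +
      replicate_mset (2 * r - 3) (enat (3 * r^2 + 7)) +
      replicate_mset (r - 3) (enat (3 * r^2 + r + 5)) +
      replicate_mset 2 (enat (3 * r^2 + r + 6))"
proof -
  have "card (H_verts r) = mixed_moore_bound r 1 2"
    by (simp add: card_H_verts mixed_moore_bound_2 power2_eq_square)
  then show ?thesis
    using H_mixed_graph[OF assms] H_totally_regular[OF assms] H_radius_diameter[OF assms]
      H_status_vector[OF assms]
    by (simp add: mixed_radial_moore_graph_def)
qed

end
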